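(* Let $Q(\zeta)=|\zeta|^{2\lambda}-\frac{2c}N\log|\zeta|$, and let $K_N$ be the rescaled kernel at the origin of the planar symplectic ensemble with potential $Q$ (see the context). For each $\lambda>0$ and $c>-1$, there exists a sequence of cocycles $(c_N)_{N=1}^\infty$ such that $$\lim_{N\to\infty}c_N\cdot K_N(z,w)=K_{\lambda,c}(z,w)=e^{-\frac{|z|^{2\lambda}+|w|^{2\lambda}}\lambda}\begin{pmatrix}\kappa_{\lambda,c}(z,w)&\kappa_{\lambda,c}(z,\bar w)\\ \kappa_{\lambda,c}(\bar z,w)&\kappa_{\lambda,c}(\bar z,\bar w)\end{pmatrix}$$ uniformly for $z,w$ in compact subsets of $\mathbb C$, where $$\kappa_{\lambda,c}(z,w)=\Big(\frac2\lambda\Big)^{\frac1{2\lambda}}(zw)^{\lambda-1}\,\widetilde\kappa_{\lambda,c}\Big(\sqrt{\tfrac2\lambda}\,z^\lambda,\sqrt{\tfrac2\lambda}\,w^\lambda\Big).$$ Here $\widetilde\kappa_{\lambda,c}$ is given in terms of a function $\widetilde G$ as $$\widetilde\kappa_{\lambda,c}(z,w)=\widetilde G(z,w)-\widetilde G(w,z),$$ and the following fractional differential equations hold: $$D_z^{\frac1\lambda}\widetilde G(z,w)=z^{\frac1\lambda}\widetilde G(z,w)+(zw)^{\frac{1+c}\lambda-1}E_{\frac2\lambda,\frac{1+c}\lambda}\big((zw)^{\frac2\lambda}\big),$$ $$D_z^{\frac1\lambda}\widetilde\kappa_{\lambda,c}(z,w)=z^{\frac1\lambda}\widetilde\kappa_{\lambda,c}(z,w)+(zw)^{\frac{1+c}\lambda-1}E_{\frac1\lambda,\frac{1+c}\lambda}\big((zw)^{\frac1\lambda}\big)-\frac{\Gamma(\frac{1+c}\lambda)}{\Gamma(\frac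 c\lambda)\Gamma(\frac{2+c}\lambda)}(zw)^{\frac{1+c}\lambda-1}(w/z)^{\frac1\lambda}E_{\frac1\lambda,2,3+c-\lambda}\big(w^{\frac2\lambda}\big).$$
   Context: Ensemble. Write $dA(\zeta)=\frac1\pi d^2\zeta$. The planar symplectic ensemble with potential $Q$ is the probability measure on $\mathbb C^N$ with density $\frac1{Z_N}e^{-\mathbf H_N}$ with respect to $\prod_jdA(\zeta_j)$, where $$\mathbf H_N=\sum_{j\ne k}\log\frac1{|\zeta_j-\zeta_k||\zeta_j-\bar\zeta_k|}+\sum_{j=1}^N\Big(\log\frac1{|\zeta_j-\bar\zeta_j|^2}+NQ(\zeta_j)\Big).$$ It is a Pfaffian point process with pre-kernel $$\boldsymbol\varkappa_N(\zeta,\eta)=\sum_{k=0}^{N-1}\frac{q_{2k+1}(\zeta)q_{2k}(\eta)-q_{2k}(\zeta)q_{2k+1}(\eta)}{s_k},$$ where the $q_k$ are skew-orthogonal polynomials with skew-norms $s_k$; for the present $Q$, $$q_{2k+1}(\zeta)=\zeta^{2k+1},\quad q_{2k}(\zeta)=\zeta^{2k}+\sum_{l=0}^{k-1}\frac{\zeta^{2l}}{N^{\frac{k-l}\lambda}}\prod_{j=0}^{k-l-1}\frac{\Gamma(\frac{2l+2j+3+c}\lambda)}{\Gamma(\frac{2l+2j+2+c}\lambda)},\quad s_k=\frac2\lambda\,\frac{\Gamma(\frac{2k+c+2}\lambda)}{N^{\frac{2k+c+2}\lambda}}.$$ Rescaling at the origin. With $r_N=(\lambda N/2)^{-1/(2\lambda)}$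 set $\kappa_N(z,w)=r_N^3\,\boldsymbol\varkappa_N(r_Nz,r_Nw)$ and $$K_N(z,w)=e^{-\frac N2(Q(r_Nz)+Q(r_Nw))}\begin{pmatrix}\kappa_N(z,w)&\kappa_N(z,\bar w)\\ \kappa_N(\bar z,w)&\kappa_N(\bar z,\bar w)\end{pmatrix}.$$ Cocycles. A cocycle is a function of the form $c(z,w)=h(z)h(w)$ with $h$ a (continuous) unimodular function satisfying $h(\bar z)=1/h(z)$; $c\cdot K$ denotes the kernel obtained by replacing each entry $\kappa(x,y)$, $x\in\{z,\bar z\}$, $y\in\{w,\bar w\}$, by $c(x,y)\kappa(x,y)$. Multiplying by a cocycle does not change the correlation functions. The function $\kappa_{\lambda,c}$ is holomorphic in both variables with branch cuts; the correlation functions do not depend on the choice of branches, this issue is ignored, and the monodromy of the pre-kernel can also be interpreted as a cocycle. Fractional derivative. $D_z^\nu$ is the Caputo fractional derivative $$D_z^\nu f(z)=\frac1{\Gamma(n-\nu)}\int_0^z(z-u)^{n-\nu-1}f^{(n)}(u)\,du,\qquad n-1<\nu<n,\ n\in\mathbb N,$$ where $f^{(n)}$ is the usual $n$-th derivative; for integer $\nu$ it is the ordinary derivative of order $\nu$. Special functions. $E_{a,b}(z)=\sum_{k=0}^\infty\frac{z^k}{\Gamma(ak+b)}$ (two-parametric Mittag-Leffler function) and $$E_{\alpha,m,l}(z)=1+\sum_{k=1}^\infty z^k\prod_{j=0}^{k-1}\frac{\Gamma(\alpha(jm+l)+1)}{\Gamma(\alpha(jm+l+1)+1)}$$ (three-parametric,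 Kilbas–Saigo).
   Formalization: For c<0, uniformity near 0 holds only after removing |zw|^c; Caputo equations are stated where the Caputo integral is valid (1/λ integer, or (2+c)/λ resp. (1+c)/λ > ⌈1/λ⌉), Riemann–Liouville ones for all λ,c; cocycles are continuous off the cut (-∞,0]; κ is continued from the principal sector if λ>1. *)

theory Defs
  imports "HOL-Complex_Analysis.Complex_Analysis"
begin

section \<open>The rescaled kernel of the ensemble\<close>

definition Q_pot :: "real \<Rightarrow> real \<Rightarrow> nat \<Rightarrow> complex \<Rightarrow> real" where
  "Q_pot lam c N \<zeta> = cmod \<zeta> powr (2 * lam) - 2 * c / real N * ln (cmod \<zeta>)"

text \<open>
  The factor exp (- N Q / 2).  At the origin \<open>Q\<close> is \<open>+\<infinity>\<close> for \<open>c > 0\<close>, so the factor is 0 there,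
  whereas HOL has \<open>ln 0 = 0\<close>.  For \<open>c < 0\<close> the factor is infinite at the origin; the value 0 given
  to it here is a dummy, and the origin is excluded below.
\<close>
definition half_weight :: "real \<Rightarrow> real \<Rightarrow> nat \<Rightarrow> complex \<Rightarrow> real" where
  "half_weight lam c N \<zeta> =
     (if \<zeta> = 0 \<and> c \<noteq> 0 then 0 else exp (- (real N / 2) * Q_pot lam c N \<zeta>))"

definition q_odd :: "nat \<Rightarrow> complex \<Rightarrow> complex" where
  "q_odd k \<zeta> = \<zeta> ^ (2 * k + 1)"

definition q_even :: "real \<Rightarrow> real \<Rightarrow> nat \<Rightarrow> nat \<Rightarrow> complex \<Rightarrow> complex" where
  "q_even lam c N k \<zeta> = \<zeta> ^ (2 * k) +
     (\<Sum>l<k. \<zeta> ^ (2 * l) / of_real (real N powr (real (k - l) / lam)) *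
        of_real (\<Prod>j<k - l. Gamma ((2 * real l + 2 * real j + 3 + c) / lam)
                          / Gamma ((2 * real l + 2 * real j + 2 + c) / lam)))"

definition skew_norm :: "real \<Rightarrow> real \<Rightarrow> nat \<Rightarrow> nat \<Rightarrow> real" where
  "skew_norm lam c N k = 2 / lam * Gamma ((2 * real k + c + 2) / lam)
     / real N powr ((2 * real k + c + 2) / lam)"

definition prekernel :: "real \<Rightarrow> real \<Rightarrow> nat \<Rightarrow> complex \<Rightarrow> complex \<Rightarrow> complex" where
  "prekernel lam c N \<zeta> \<eta> =
     (\<Sum>k<N. (q_odd k \<zeta> * q_even lam c N k \<eta> - q_even lam c N k \<zeta> * q_odd k \<eta>)
            / of_real (skew_norm lam c N k))"

definition r_scale :: "real \<Rightarrow> nat \<Rightarrow> real" where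
  "r_scale lam N = (lam * real N / 2) powr (- 1 / (2 * lam))"

definition prekernel_rescaled :: "real \<Rightarrow> real \<Rightarrow> nat \<Rightarrow> complex \<Rightarrow> complex \<Rightarrow> complex" where
  "prekernel_rescaled lam c N z w =
     of_real (r_scale lam N ^ 3) *
     prekernel lam c N (of_real (r_scale lam N) * z) (of_real (r_scale lam N) * w)"

definition weight_rescaled :: "real \<Rightarrow> real \<Rightarrow> nat \<Rightarrow> complex \<Rightarrow> complex \<Rightarrow> real" where
  "weight_rescaled lam c N z w =
     half_weight lam c N (of_real (r_scale lam N) * z) *
     half_weight lam c N (of_real (r_scale lam N) * w)"

definition weight_limit :: "real \<Rightarrow> complex \<Rightarrow> complex \<Rightarrow> real" where
  "weight_limit lam z w = exp (- (cmod z powr (2 * lam) + cmod w powr (2 * lam)) / lam)"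

definition kernel_matrix ::
  "(complex \<Rightarrow> complex \<Rightarrow> real) \<Rightarrow> (complex \<Rightarrow> complex \<Rightarrow> complex) \<Rightarrow> complex \<Rightarrow> complex \<Rightarrow> complex^2^2"
where
  "kernel_matrix \<omega> \<kappa> z w = \<omega> z w *\<^sub>R
     vector [vector [\<kappa> z w, \<kappa> z (cnj w)],
             vector [\<kappa> (cnj z) w, \<kappa> (cnj z) (cnj w)]]"

section \<open>Cocycles\<close>

text \<open>
  All branch cuts are placed on the closed negative half-line, and \<open>- \<real>\<^sub>\<le>\<^sub>0\<close> is the slit plane.
  Unimodularity and the reflection law are required on all of the complex plane; continuity is
  required only off the cut, because the limiting pre-kernel has monodromy exp (2 pi i c)
  around the origin.
\<close>
definition cocycle :: "(complex \<Rightarrow> complex \<Rightarrow> complex) \<Rightarrow> bool" where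
  "cocycle C \<longleftrightarrow>
     (\<exists>h. continuous_on (- \<real>\<^sub>\<le>\<^sub>0) h \<and> (\<forall>z. cmod (h z) = 1) \<and> (\<forall>z. h (cnj z) = 1 / h z) \<and>
          (\<forall>z w. C z w = h z * h w))"

definition cocycle_kernel ::
  "(complex \<Rightarrow> complex \<Rightarrow> complex) \<Rightarrow> real \<Rightarrow> real \<Rightarrow> nat \<Rightarrow> complex \<Rightarrow> complex \<Rightarrow> complex^2^2"
where
  "cocycle_kernel C lam c N =
     kernel_matrix (weight_rescaled lam c N) (\<lambda>x y. C x y * prekernel_rescaled lam c N x y)"

definition holomorphic_in_both :: "(complex \<Rightarrow> complex \<Rightarrow> complex) \<Rightarrow> complex set \<Rightarrow> bool" where
  "holomorphic_in_both F D \<longleftrightarrow>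
     (\<forall>w\<in>D. (\<lambda>z. F z w) holomorphic_on D) \<and> (\<forall>z\<in>D. (\<lambda>w. F z w) holomorphic_on D)"

section \<open>Fractional derivatives\<close>

text \<open>
  Fractional derivatives of a function holomorphic on the slit plane, as relations
  (so that convergence of the integrals is part of the assertion).  Integration is along the segment
  from 0 to \<open>z\<close>, on which the principal power of \<open>z - u\<close> is the one required.
\<close>
definition has_caputo_derivative ::
  "(complex \<Rightarrow> complex) \<Rightarrow> real \<Rightarrow> complex \<Rightarrow> complex \<Rightarrow> bool" where
  "has_caputo_derivative f \<nu> z D \<longleftrightarrow>
     (if \<nu> \<in> \<nat> then D = (deriv ^^ nat \<lfloor>\<nu>\<rfloor>) f z
      else let n = nat \<lceil>\<nu>\<rceil> in
        \<exists>I. ((\<lambda>u. (z - u) powr of_real (real n - \<nu> - 1) * (deriv ^^ n) f u)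
               has_contour_integral I) (linepath 0 z) \<and>
            D = I / of_real (Gamma (real n - \<nu>)))"

text \<open>
  The Riemann--Liouville derivative, that is, the n-th derivative of the fractional integral of order
  \<open>n - \<nu>\<close>.  It agrees with the Caputo derivative on \<open>z powr p\<close> whenever \<open>p > n - 1\<close>.  For
  non-integer \<open>\<nu>\<close> and real \<open>p\<close> with \<open>-1 < p \<le> n - 1\<close>, the Caputo integral either diverges at the
  origin or, if \<open>p\<close> is an integer, vanishes.
\<close>
definition has_RL_derivative ::
  "(complex \<Rightarrow> complex) \<Rightarrow> real \<Rightarrow> complex \<Rightarrow> complex \<Rightarrow> bool" where
  "has_RL_derivative f \<nu> z D \<longleftrightarrow>
     (if \<nu> \<in> \<nat> then D = (deriv ^^ nat \<lfloor>\<nu>\<rfloor>) f z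
      else let n = nat \<lceil>\<nu>\<rceil> in
        \<exists>F. F holomorphic_on (- \<real>\<^sub>\<le>\<^sub>0) \<and>
            (\<forall>x \<in> - \<real>\<^sub>\<le>\<^sub>0. \<exists>I. ((\<lambda>u. (x - u) powr of_real (real n - \<nu> - 1) * f u)
               has_contour_integral I) (linepath 0 x) \<and>
               F x = I / of_real (Gamma (real n - \<nu>))) \<and>
            D = (deriv ^^ n) F z)"

section \<open>Special functions\<close>

definition mittag_leffler :: "real \<Rightarrow> real \<Rightarrow> complex \<Rightarrow> complex" where
  "mittag_leffler a b z = (\<Sum>k. z ^ k / of_real (Gamma (a * real k + b)))"

definition kilbas_saigo :: "real \<Rightarrow> real \<Rightarrow> real \<Rightarrow> complex \<Rightarrow> complex" where
  "kilbas_saigo \<alpha> m l z =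
     1 + (\<Sum>k. z ^ Suc k * of_real (\<Prod>j<Suc k. Gamma (\<alpha> * (real j * m + l) + 1)
                                             / Gamma (\<alpha> * (real j * m + l + 1) + 1)))"

section \<open>Right-hand sides of the differential equations\<close>

text \<open>
  The branch of a power of \<open>z * w\<close> or \<open>w / z\<close> is the one given by the product or quotient of the
  principal powers of \<open>z\<close> and \<open>w\<close>; it is holomorphic for \<open>z\<close> and \<open>w\<close> in the slit plane.
\<close>
definition pow_mult :: "complex \<Rightarrow> complex \<Rightarrow> real \<Rightarrow> complex" where
  "pow_mult z w a = z powr of_real a * w powr of_real a"

definition pow_div :: "complex \<Rightarrow> complex \<Rightarrow> real \<Rightarrow> complex" where
  "pow_div w z a = w powr of_real a / z powr of_real a"

definition rhs_G ::
  "real \<Rightarrow> real \<Rightarrow> (complex \<Rightarrow> complex \<Rightarrow> complex) \<Rightarrow> complex \<Rightarrow> complex \<Rightarrow> complex" where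
  "rhs_G lam c G z w =
     z powr of_real (1 / lam) * G z w
     + pow_mult z w ((1 + c) / lam - 1)
       * mittag_leffler (2 / lam) ((1 + c) / lam) (pow_mult z w (2 / lam))"

text \<open>
  HOL's \<open>Gamma\<close> is 0 at its poles, so the coefficient with \<open>Gamma (c / lam)\<close> in the denominator is 0
  when \<open>c / lam\<close> is a nonpositive integer, as it should be.
\<close>
definition rhs_\<kappa> ::
  "real \<Rightarrow> real \<Rightarrow> (complex \<Rightarrow> complex \<Rightarrow> complex) \<Rightarrow> complex \<Rightarrow> complex \<Rightarrow> complex" where
  "rhs_\<kappa> lam c \<kappa>t z w =
     z powr of_real (1 / lam) * \<kappa>t z w
     + pow_mult z w ((1 + c) / lam - 1)
       * mittag_leffler (1 / lam) ((1 + c) / lam) (pow_mult z w (1 / lam))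
     - of_real (Gamma ((1 + c) / lam) / (Gamma (c / lam) * Gamma ((2 + c) / lam)))
       * pow_mult z w ((1 + c) / lam - 1) * pow_div w z (1 / lam)
       * kilbas_saigo (1 / lam) 2 (3 + c - lam) (w powr of_real (2 / lam))"

section \<open>The limiting pre-kernel\<close>

text \<open>
  \<open>\<kappa>\<close> is the function given by
  \<open>(2/\<lambda>)^(1/(2\<lambda>)) (z w)^(\<lambda>-1) \<kappa>t (sqrt (2/\<lambda>) z^\<lambda>, sqrt (2/\<lambda>) w^\<lambda>)\<close> on the slit plane.
  For \<open>\<lambda> > 1\<close> the point \<open>z^\<lambda>\<close> may leave the principal sheet, on which \<open>\<kappa>t\<close> is given;
  \<open>\<kappa>\<close> is then the analytic continuation, in each variable, from the sector where it does not.
\<close>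
definition limit_prekernel ::
  "real \<Rightarrow> (complex \<Rightarrow> complex \<Rightarrow> complex) \<Rightarrow> (complex \<Rightarrow> complex \<Rightarrow> complex) \<Rightarrow> bool" where
  "limit_prekernel lam \<kappa>t \<kappa> \<longleftrightarrow>
     holomorphic_in_both \<kappa> (- \<real>\<^sub>\<le>\<^sub>0) \<and>
     (\<forall>z \<in> - \<real>\<^sub>\<le>\<^sub>0. \<forall>w \<in> - \<real>\<^sub>\<le>\<^sub>0. lam * \<bar>Arg z\<bar> < pi \<and> lam * \<bar>Arg w\<bar> < pi \<longrightarrow>
        \<kappa> z w = of_real ((2 / lam) powr (1 / (2 * lam))) * pow_mult z w (lam - 1) *
          \<kappa>t (of_real (sqrt (2 / lam)) * z powr of_real lam)
             (of_real (sqrt (2 / lam)) * w powr of_real lam))"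

end

theory Submission
  imports Defs
begin

text \<open>
  Writing \<open>\<nu> = 1 / lam\<close>, the powers of \<open>N\<close> in the rescaled weight and pre-kernel cancel exactly, so that the
  rescaled pre-kernel is, up to the phase \<open>exp (\<i> c Arg z)\<close> of \<open>z powr c\<close>, a partial sum of a fixed double
  power series; this phase is the cocycle, and convergence is the Weierstrass M-test.  The series converges
  since \<open>\<Gamma>(x) / \<Gamma>(x + \<nu>)\<close> tends to 0.  In the variables \<open>sqrt (2 / lam) z powr lam\<close> it becomes a double series
  of powers \<open>z powr ((2 k + 2 + c) \<nu> - 1) w powr ((2 l + 1 + c) \<nu> - 1)\<close>.  A fractional derivative of order \<open>\<nu>\<close>
  acts on it term by term (Beta integrals and dominated convergence), multiplying each coefficient by a
  quotient of Gamma values that shifts \<open>k\<close> or \<open>l\<close> by one; the boundary terms of the shift, at \<open>k = l\<close> and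
  \<open>l = 0\<close>, give the Mittag-Leffler and Kilbas--Saigo functions.
\<close>

section \<open>Power series with real exponents\<close>

text \<open>Two singularities at the origin shape what is proved. A Caputo derivative of non-integer
  order 1/lam differentiates n times, n being 1/lam rounded up, before it integrates, and the result
  need not be integrable at 0 unless the lowest exponent exceeds n - 1. The lowest exponents of G(z,
  w) are (2 + c)/lam - 1 in z and (1 + c)/lam - 1 in w. Hence the two Caputo equations carry
  different conditions, the stricter one for the kernel, which also contains G(w, z). The
  Riemann-Liouville derivative integrates before it differentiates and asks only for exponents above
  -1, which c > -1 ensures. The other singularity is the factor |z|^c of the weight: for c < 0
  uniform convergence is proved away from the origin, and up to it after multiplication by |z
  w|^(-c). The double series must be summable in either order, because z is the first variable of
  G(z, w) and the second one of G(w, z). Decay within each column of coefficients does not suffice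
  for this; the bound has to be uniform over the columns and better than any geometric rate.\<close>

lemma Gamma_ratio_tendsto_0:
  fixes \<nu> :: real
  assumes "\<nu> > 0"
  shows "((\<lambda>x. Gamma x / Gamma (x + \<nu>)) \<longlongrightarrow> 0) at_top"
proof (rule tendsto_sandwich[OF _ _ tendsto_const])
  show "((\<lambda>x::real. (x - 1) powr (- \<nu>)) \<longlongrightarrow> 0) at_top"
    using assms by real_asymp
  show "\<forall>\<^sub>F x in at_top. Gamma x / Gamma (x + \<nu>) \<ge> 0"
    by (rule eventually_mono[OF eventually_gt_at_top[of 0]])
       (use assms in \<open>auto intro!: divide_nonneg_pos less_imp_le Gamma_real_pos\<close>)
  show "\<forall>\<^sub>F x in at_top. Gamma x / Gamma (x + \<nu>) \<le> (x - 1) powr (- \<nu>)"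
    using eventually_gt_at_top[of 1]
  proof eventually_elim
    fix x :: real assume x: "x > 1"
    define L where "L = ln \<circ> (Gamma :: real \<Rightarrow> real)"
    have "Gamma x = (x - 1) * Gamma (x - 1)"
      using x Gamma_plus1[of "x - 1"] nonpos_Ints_nonpos[of "x - 1"] by force
    then have Lx: "L x = ln (x - 1) + L (x - 1)"
      using x Gamma_real_pos[of "x - 1"] by (simp add: L_def ln_mult del: Gamma_real_pos)
    \<comment> \<open>By log-convexity the slope of the logarithm of Gamma after \<open>x\<close> is at least its slope
      \<open>ln (x - 1)\<close> between \<open>x - 1\<close> and \<open>x\<close>.\<close>
    have "(L (x - 1) - L x) / ((x - 1) - x) \<le> (L (x - 1) - L (x + \<nu>)) / ((x - 1) - (x + \<nu>))"
      "(L (x - 1) - L (x + \<nu>)) / ((x - 1) - (x + \<nu>)) \<le> (L x - L (x + \<nu>)) / (x - (x + \<nu>))"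
      using convex_on_slope_le[OF log_convex_Gamma_real, of "x - 1" "x + \<nu>" x] x assms
      by (auto simp: L_def)
    then have "(L (x - 1) - L x) / ((x - 1) - x) \<le> (L x - L (x + \<nu>)) / (x - (x + \<nu>))"
      by linarith
    then have "ln (x - 1) \<le> (L (x + \<nu>) - L x) / \<nu>"
      using Lx assms by (simp add: field_simps)
    then have "\<nu> * ln (x - 1) \<le> L (x + \<nu>) - L x"
      using assms by (simp add: field_simps)
    then have "exp (L x - L (x + \<nu>)) \<le> exp (- \<nu> * ln (x - 1))" by simp
    then show "Gamma x / Gamma (x + \<nu>) \<le> (x - 1) powr (- \<nu>)"
      using x assms by (simp add: L_def exp_diff powr_def)
  qed
qed

lemma Gamma_ratio_seq_tendsto_0:
  fixes \<nu> b q :: real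
  assumes "\<nu> > 0" "b > 0"
  shows "(\<lambda>k. Gamma (q + real k * b) / Gamma (q + real k * b + \<nu>)) \<longlonglongrightarrow> 0"
proof (rule filterlim_compose[OF Gamma_ratio_tendsto_0[OF assms(1)]])
  show "filterlim (\<lambda>k. q + real k * b) at_top sequentially"
    using assms(2) by real_asymp
qed

text \<open>Infinite radius of convergence. A negative \<open>R\<close> gives terms of the same
  absolute value as \<open>-R\<close>, so quantifying over all reals is the usual condition.\<close>

definition entire_coeffs :: "(nat \<Rightarrow> complex) \<Rightarrow> bool" where
  "entire_coeffs a \<longleftrightarrow> (\<forall>R::real. summable (\<lambda>k. norm (a k) * R ^ k))"

lemma entire_coeffs_summable_norm:
  "entire_coeffs a \<Longrightarrow> summable (\<lambda>k. norm (a k * y ^ k))"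
  by (simp add: entire_coeffs_def norm_mult norm_power)

lemma entire_coeffs_summable: "entire_coeffs a \<Longrightarrow> summable (\<lambda>k. a k * y ^ k)"
  by (rule summable_norm_cancel[OF entire_coeffs_summable_norm])

text \<open>A factor of geometric growth is absorbed by passing from the radius \<open>R\<close> to
  \<open>B * \<bar>R\<bar>\<close>.\<close>

lemma entire_coeffs_bound:
  assumes a: "entire_coeffs a" and le: "\<And>k. norm (e k) \<le> C * B ^ k * norm (a k)" and "B \<ge> 0"
  shows "entire_coeffs e"
  unfolding entire_coeffs_def
proof
  fix R :: real
  have "summable (\<lambda>k. C * (norm (a k) * (B * \<bar>R\<bar>) ^ k))"
    using a unfolding entire_coeffs_def by (intro summable_mult) blast
  then show "summable (\<lambda>k. norm (e k) * R ^ k)"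
  proof (rule summable_comparison_test')
    fix k
    have "norm (e k) * \<bar>R\<bar> ^ k \<le> C * B ^ k * norm (a k) * \<bar>R\<bar> ^ k"
      using le by (intro mult_right_mono) auto
    then show "norm (norm (e k) * R ^ k) \<le> C * (norm (a k) * (B * \<bar>R\<bar>) ^ k)"
      by (simp add: abs_mult power_abs power_mult_distrib mult_ac)
  qed
qed

lemma entire_coeffs_mult_bounded:
  assumes "entire_coeffs a" "\<And>k. norm (d k) \<le> C"
  shows "entire_coeffs (\<lambda>k. d k * a k)"
  by (rule entire_coeffs_bound[OF assms(1), of _ C 1])
     (simp_all add: norm_mult mult_right_mono assms(2))

text \<open>The factor is the exponent that a differentiation brings down. The crude bound k \<le>
  2^k is enough, since geometric factors cost nothing.\<close>

lemma entire_coeffs_mult_linear: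
  assumes "entire_coeffs a"
  shows "entire_coeffs (\<lambda>k. of_real (q + real k * b) * a k)"
proof (rule entire_coeffs_bound[OF assms, of _ "\<bar>q\<bar> + \<bar>b\<bar>" 2])
  fix k :: nat
  have *: "1 \<le> (2::real) ^ k" "real k \<le> 2 ^ k" using of_nat_less_two_power[of k] by auto
  have "\<bar>q + real k * b\<bar> \<le> \<bar>q\<bar> + \<bar>b\<bar> * real k"
    by (metis abs_mult abs_of_nat abs_triangle_ineq mult.commute)
  also have "\<dots> \<le> \<bar>q\<bar> * 2 ^ k + \<bar>b\<bar> * 2 ^ k"
    using * mult_left_mono[OF *(1), of "\<bar>q\<bar>"] mult_left_mono[OF *(2), of "\<bar>b\<bar>"] by simp
  finally have "\<bar>q + real k * b\<bar> \<le> (\<bar>q\<bar> + \<bar>b\<bar>) * 2 ^ k" by (simp add: algebra_simps)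
  then show "norm (of_real (q + real k * b) * a k) \<le> (\<bar>q\<bar> + \<bar>b\<bar>) * 2 ^ k * norm (a k)"
    unfolding norm_mult norm_of_real by (intro mult_right_mono) auto
qed simp

text \<open>The series of the powers with exponents q + k b, written as a power times an entire
  function of z^b. At the origin its value is 0 for every \<open>q\<close>, because
  \<open>0 powr q = 0\<close>.\<close>

definition gen_pseries :: "real \<Rightarrow> real \<Rightarrow> (nat \<Rightarrow> complex) \<Rightarrow> complex \<Rightarrow> complex" where
  "gen_pseries q b a z = z powr of_real q * (\<Sum>k. a k * (z powr of_real b) ^ k)"

lemma has_field_derivative_gen_pseries:
  assumes a: "entire_coeffs a" and z: "z \<notin> \<real>\<^sub>\<le>\<^sub>0"
  shows "(gen_pseries q b a has_field_derivative
           gen_pseries (q - 1) b (\<lambda>k. of_real (q + real k * b) * a k) z) (at z)"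
proof -
  define y where "y = z powr of_real b"
  have z0: "z \<noteq> 0" using z by auto
  note sm = entire_coeffs_summable[OF a]
  have D: "((\<lambda>x. \<Sum>n. a n * x ^ n) has_field_derivative (\<Sum>n. diffs a n * y ^ n)) (at y)"
    by (rule termdiffs_strong_converges_everywhere) (rule sm)
  \<comment> \<open>The factor \<open>y\<close> is supplied by the chain rule, through
    \<open>z powr (b - 1) * z powr q = y * z powr (q - 1)\<close>; it keeps the index of the derived
    series unshifted.\<close>
  have yd: "(\<Sum>n. diffs a n * y ^ n) * y = (\<Sum>n. of_nat n * a n * y ^ n)"
  proof -
    have "summable (\<lambda>n. diffs a n * y ^ n)"
      by (rule termdiff_converges_all) (rule sm)
    then have "(\<Sum>n. diffs a n * y ^ n) * y = (\<Sum>n. diffs a n * y ^ n * y)"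
      by (rule suminf_mult2)
    also have "\<dots> = (\<Sum>n. of_nat (Suc n) * a (Suc n) * y ^ Suc n)"
      by (simp add: diffs_def mult_ac)
    also have "\<dots> = (\<Sum>n. of_nat n * a n * y ^ n)"
    proof -
      have "entire_coeffs (\<lambda>n. of_nat n * a n)"
        using entire_coeffs_mult_linear[OF a, of 0 1] by simp
      from entire_coeffs_summable[OF this, of y] show ?thesis
        using suminf_split_head[of "\<lambda>n. of_nat n * a n * y ^ n"] by simp
    qed
    finally show ?thesis .
  qed
  have sum2: "(\<Sum>k. of_real (q + real k * b) * a k * y ^ k) =
      of_real q * (\<Sum>k. a k * y ^ k) + of_real b * (\<Sum>n. of_nat n * a n * y ^ n)"
  proof -
    have "entire_coeffs (\<lambda>n. of_nat n * a n)"
      using entire_coeffs_mult_linear[OF a, of 0 1] by simp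
    from summable_mult[OF entire_coeffs_summable[OF this], of "of_real b" y]
    show ?thesis
      using suminf_add[OF summable_mult[OF sm[of y], of "of_real q"],
          of "\<lambda>n. of_real b * (of_nat n * a n * y ^ n)"]
        suminf_mult[OF sm, of "of_real q" y]
        suminf_mult[OF entire_coeffs_summable[OF \<open>entire_coeffs (\<lambda>n. of_nat n * a n)\<close>], of "of_real b" y]
      by (simp add: algebra_simps)
  qed
  have pw: "((\<lambda>z. z powr of_real r) has_field_derivative
      of_real r * z powr of_real (r - 1)) (at z)" for r
    using has_field_derivative_powr[OF z, of "of_real r"] by simp
  have "((\<lambda>z. z powr of_real q * (\<Sum>k. a k * (z powr of_real b) ^ k)) has_field_derivative
      of_real q * z powr of_real (q - 1) * (\<Sum>k. a k * y ^ k)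
      + (\<Sum>n. diffs a n * y ^ n) * (of_real b * z powr of_real (b - 1)) * z powr of_real q) (at z)"
    using DERIV_mult[OF pw[of q] DERIV_chain2[OF D[unfolded y_def] pw[of b]]]
    by (simp add: y_def)
  moreover have "z powr of_real (b - 1) * z powr of_real q = y * z powr of_real (q - 1)"
    by (simp add: y_def flip: powr_add) (simp add: algebra_simps)
  then have "of_real q * z powr of_real (q - 1) * (\<Sum>k. a k * y ^ k)
      + (\<Sum>n. diffs a n * y ^ n) * (of_real b * z powr of_real (b - 1)) * z powr of_real q
      = gen_pseries (q - 1) b (\<lambda>k. of_real (q + real k * b) * a k) z"
    unfolding gen_pseries_def y_def[symmetric] sum2 yd[symmetric]
    by (simp add: algebra_simps)
  ultimately show ?thesis
    unfolding gen_pseries_def[abs_def] by (simp add: y_def)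
qed

lemma holomorphic_gen_pseries:
  "entire_coeffs a \<Longrightarrow> gen_pseries q b a holomorphic_on (- \<real>\<^sub>\<le>\<^sub>0)"
  by (rule holomorphic_onI, rule field_differentiable_at_within)
     (auto simp: field_differentiable_def intro: has_field_derivative_gen_pseries)

lemma entire_coeffs_cmult: "entire_coeffs a \<Longrightarrow> entire_coeffs (\<lambda>k. d * a k)"
  by (rule entire_coeffs_mult_bounded[of a "\<lambda>_. d" "norm d"]) auto

lemma gen_pseries_cmult:
  assumes "entire_coeffs a"
  shows "gen_pseries q b (\<lambda>k. d * a k) z = d * gen_pseries q b a z"
  unfolding gen_pseries_def mult.assoc suminf_mult[OF entire_coeffs_summable[OF assms]]
  by (rule mult.left_commute)

text \<open>With p = q + k b the Pochhammer symbol is the falling factorial p (p - 1) ... (p - n +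
  1), the factor produced by n differentiations.\<close>

lemma entire_coeffs_mult_pochhammer:
  assumes "entire_coeffs a"
  shows "entire_coeffs (\<lambda>k. of_real (pochhammer (q + real k * b + 1 - real n) n) * a k)"
proof (induction n)
  case 0 then show ?case using assms by simp
next
  case (Suc n)
  have "entire_coeffs (\<lambda>k. of_real (q - real n + real k * b) *
     (of_real (pochhammer (q + real k * b + 1 - real n) n) * a k))"
    by (rule entire_coeffs_mult_linear[OF Suc])
  moreover have "pochhammer (q + real k * b + 1 - real (Suc n)) (Suc n) =
     (q - real n + real k * b) * pochhammer (q + real k * b + 1 - real n) n" for k
    by (simp add: pochhammer_rec algebra_simps)
  ultimately show ?case by (simp add: mult_ac)
qed

lemma higher_deriv_gen_pseries:
  assumes a: "entire_coeffs a" and z: "z \<notin> \<real>\<^sub>\<le>\<^sub>0"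
  shows "(deriv ^^ n) (gen_pseries q b a) z =
    gen_pseries (q - real n) b
      (\<lambda>k. of_real (pochhammer (q + real k * b + 1 - real n) n) * a k) z"
  using z
proof (induction n arbitrary: z)
  case (Suc n)
  let ?c = "\<lambda>k. of_real (pochhammer (q + real k * b + 1 - real n) n) * a k"
  have "\<forall>\<^sub>F w in nhds z. w \<in> - \<real>\<^sub>\<le>\<^sub>0"
    using Suc.prems by (intro eventually_nhds_in_open) auto
  then have "\<forall>\<^sub>F w in nhds z. (deriv ^^ n) (gen_pseries q b a) w = gen_pseries (q - real n) b ?c w"
    by (rule eventually_mono) (use Suc.IH in auto)
  then have "deriv ((deriv ^^ n) (gen_pseries q b a)) z = deriv (gen_pseries (q - real n) b ?c) z"
    by (rule deriv_cong_ev) simp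
  also have "\<dots> = gen_pseries (q - real n - 1) b (\<lambda>k. of_real (q - real n + real k * b) * ?c k) z"
    by (intro DERIV_imp_deriv has_field_derivative_gen_pseries
        entire_coeffs_mult_pochhammer a Suc.prems)
  also have "(\<lambda>k. of_real (q - real n + real k * b) * ?c k) =
      (\<lambda>k. of_real (pochhammer (q + real k * b + 1 - real (Suc n)) (Suc n)) * a k)"
    by (rule ext) (simp add: pochhammer_rec algebra_simps)
  finally show ?case by (simp add: algebra_simps)
qed simp

section \<open>Fractional derivatives\<close>

lemma powr_of_real_mult_left:
  "t \<ge> 0 \<Longrightarrow> (of_real t * z) powr of_real r = of_real (t powr r) * z powr of_real r" for z :: complex
  by (subst powr_times_real_left) (auto simp: powr_of_real)

lemma exponent_shift_pos:
  fixes q b :: real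
  assumes "q > -1" "b > 0"
  shows "q + 1 + real k * b > 0"
  using assms mult_nonneg_nonneg[of "real k" b] by linarith

text \<open>The quotient tends to 0 and is therefore bounded; at arguments that are poles HOL still
  gives it a finite value.\<close>

lemma entire_coeffs_Gamma_ratio:
  assumes a: "entire_coeffs a" and "b > 0" "\<mu> > 0"
  shows "entire_coeffs (\<lambda>k. of_real (Gamma (q + real k * b) / Gamma (q + real k * b + \<mu>)) * a k)"
proof -
  have "Bseq (\<lambda>k. Gamma (q + real k * b) / Gamma (q + real k * b + \<mu>))"
    by (rule convergent_imp_Bseq[OF convergentI[OF Gamma_ratio_seq_tendsto_0[OF assms(3,2)]]])
  then obtain C where C: "\<And>k. norm (Gamma (q + real k * b) / Gamma (q + real k * b + \<mu>)) \<le> C"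
    unfolding Bseq_def by auto
  show ?thesis
    by (rule entire_coeffs_mult_bounded[OF a, of _ C]) (use C in \<open>simp only: norm_of_real real_norm_def\<close>)
qed

text \<open>Substituting u = t z turns the term of exponent p = q + k b into z^(p + \<mu>) times the
  integral of t^p (1 - t)^(\<mu> - 1), which is a Beta value. At z = 0 both sides are 0.\<close>

lemma fractional_integral_gen_pseries:
  assumes a: "entire_coeffs a" and q: "q > -1" and b: "b > 0" and \<mu>: "\<mu> > 0"
  shows "((\<lambda>u. (z - u) powr of_real (\<mu> - 1) * gen_pseries q b a u) has_contour_integral
     of_real (Gamma \<mu>) *
     gen_pseries (q + \<mu>) b
       (\<lambda>k. of_real (Gamma (q + 1 + real k * b) / Gamma (q + 1 + real k * b + \<mu>)) * a k) z)
     (linepath 0 z)"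
proof (cases "z = 0")
  case False
  define y where "y = z powr of_real b"
  define A where "A = z powr of_real (q + \<mu>)"
  define w where "w k t = t powr (q + real k * b) * (1 - t) powr (\<mu> - 1)" for k :: nat and t :: real
  define f where "f n t = (\<Sum>k<n. A * (a k * y ^ k) * of_real (w k t))" for n t
  define g where "g t = (z - linepath 0 z t) powr of_real (\<mu> - 1) *
    gen_pseries q b a (linepath 0 z t) * (z - 0)" for t
  define M where "M = (\<Sum>k. norm (a k * y ^ k))"
  have smn: "summable (\<lambda>k. norm (a k * y ^ k))"
    by (rule entire_coeffs_summable_norm[OF a])
  have w_int: "(w k has_integral Beta (q + 1 + real k * b) \<mu>) {0..1}" for k
    using has_integral_Beta_real[OF exponent_shift_pos[OF q b, of k] \<mu>]
    by (simp add: w_def[abs_def] algebra_simps)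
  have w0: "0 \<le> w k t" for k t by (simp add: w_def)
  \<comment> \<open>Since t^(k b) \<le> 1 on the unit interval, the integrable function
    \<open>w 0\<close> serves as majorant for all \<open>k\<close>.\<close>
  have w_le: "w k t \<le> w 0 t" if "t \<in> {0..1}" for k t
    using that b by (auto simp: w_def intro!: mult_right_mono powr_mono')
  have f_int: "(f n has_integral (\<Sum>k<n. A * (a k * y ^ k) * of_real (Beta (q + 1 + real k * b) \<mu>))) {0..1}" for n
    unfolding f_def[abs_def]
    by (intro has_integral_sum has_integral_mult_right has_integral_of_real w_int) auto
  have lim_f: "(\<lambda>n. f n t) \<longlonglongrightarrow> g t" if t: "t \<in> {0..1}" for t
  proof -
    have lp: "linepath 0 z t = of_real t * z" "z - of_real t * z = of_real (1 - t) * z"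
      by (simp_all add: linepath_def scaleR_conv_of_real algebra_simps)
    \<comment> \<open>At t = 0 both sides vanish, as \<open>0 powr r = 0\<close> for every exponent,
      including 0 and negative ones.\<close>
    have 1: "of_real (w k t) * y ^ k =
       of_real ((1 - t) powr (\<mu> - 1)) * (of_real (t powr q) * (of_real (t powr b) * y) ^ k)" for k
      using t by (cases "t = 0")
        (simp_all add: w_def powr_add mult_ac power_mult_distrib powr_power flip: of_real_power)
    have S: "(\<lambda>k. a k * (of_real (t powr b) * y) ^ k) sums (\<Sum>k. a k * (of_real (t powr b) * y) ^ k)"
      by (rule summable_sums[OF entire_coeffs_summable[OF a]])
    have "(\<lambda>k. A * (a k * y ^ k) * of_real (w k t)) = (\<lambda>k. A * of_real ((1 - t) powr (\<mu> - 1)) *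
         of_real (t powr q) * (a k * (of_real (t powr b) * y) ^ k))"
    proof
      fix k show "A * (a k * y ^ k) * of_real (w k t) = A * of_real ((1 - t) powr (\<mu> - 1)) *
         of_real (t powr q) * (a k * (of_real (t powr b) * y) ^ k)"
        using arg_cong[OF 1[of k], of "\<lambda>x. A * a k * x"] by (simp only: mult_ac)
    qed
    then have "(\<lambda>k. A * (a k * y ^ k) * of_real (w k t)) sums
       (A * of_real ((1 - t) powr (\<mu> - 1)) * of_real (t powr q) * (\<Sum>k. a k * (of_real (t powr b) * y) ^ k))"
      using sums_mult[OF S] by simp
    moreover have "A * of_real ((1 - t) powr (\<mu> - 1)) * of_real (t powr q) *
        (\<Sum>k. a k * (of_real (t powr b) * y) ^ k) = g t"
    proof -
      have "A = z powr of_real (\<mu> - 1) * z powr of_real q * z"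
        using False powr_add[of z "of_real (\<mu> - 1) + of_real q" 1]
        by (simp add: A_def powr_add powr_diff)
      moreover have "(of_real t * z) powr of_real r = of_real (t powr r) * z powr of_real r"
        "(of_real (1 - t) * z) powr of_real r = of_real ((1 - t) powr r) * z powr of_real r" for r
        using t powr_of_real_mult_left[of t z r] powr_of_real_mult_left[of "1 - t" z r] by auto
      ultimately show ?thesis
        unfolding g_def lp gen_pseries_def y_def by (simp only: mult_ac diff_zero)
    qed
    ultimately show ?thesis by (simp add: f_def sums_def)
  qed
  have bound: "norm (f n t) \<le> norm A * M * w 0 t" if t: "t \<in> {0..1}" for n t
  proof -
    have "norm (f n t) \<le> (\<Sum>k<n. norm A * norm (a k * y ^ k) * w 0 t)"
      unfolding f_def
    proof (rule sum_norm_le)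
      fix k
      show "norm (A * (a k * y ^ k) * of_real (w k t)) \<le> norm A * norm (a k * y ^ k) * w 0 t"
        unfolding norm_mult[of A] norm_mult[of _ "of_real (w k t)"] norm_of_real
        using w_le[OF t, of k] w0[of k t]
        by (intro mult_left_mono) auto
    qed
    also have "\<dots> = norm A * (\<Sum>k<n. norm (a k * y ^ k)) * w 0 t"
      by (simp add: sum_distrib_left sum_distrib_right)
    also have "\<dots> \<le> norm A * M * w 0 t"
      unfolding M_def by (intro mult_right_mono mult_left_mono sum_le_suminf smn w0) auto
    finally show ?thesis .
  qed
  have "(\<lambda>k. A * (a k * y ^ k) * of_real (Beta (q + 1 + real k * b) \<mu>)) sums
     (of_real (Gamma \<mu>) * gen_pseries (q + \<mu>) b
       (\<lambda>k. of_real (Gamma (q + 1 + real k * b) / Gamma (q + 1 + real k * b + \<mu>)) * a k) z)"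
  proof -
    have "(\<lambda>k. of_real (Gamma (q + 1 + real k * b) / Gamma (q + 1 + real k * b + \<mu>)) * a k * y ^ k) sums
      (\<Sum>k. of_real (Gamma (q + 1 + real k * b) / Gamma (q + 1 + real k * b + \<mu>)) * a k * y ^ k)"
      by (intro summable_sums entire_coeffs_summable entire_coeffs_Gamma_ratio a b \<mu>)
    from sums_mult[OF this, of "of_real (Gamma \<mu>) * A"]
    show ?thesis
      by (simp add: gen_pseries_def A_def y_def Beta_def mult_ac)
  qed
  then have lim_I: "(\<lambda>n. \<Sum>k<n. A * (a k * y ^ k) * of_real (Beta (q + 1 + real k * b) \<mu>)) \<longlonglongrightarrow>
     of_real (Gamma \<mu>) * gen_pseries (q + \<mu>) b
       (\<lambda>k. of_real (Gamma (q + 1 + real k * b) / Gamma (q + 1 + real k * b + \<mu>)) * a k) z"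
    by (simp add: sums_def)
  have "(g has_integral (of_real (Gamma \<mu>) * gen_pseries (q + \<mu>) b
       (\<lambda>k. of_real (Gamma (q + 1 + real k * b) / Gamma (q + 1 + real k * b + \<mu>)) * a k) z)) {0..1}"
  proof (rule has_integral_dominated_convergence[OF f_int _ _ _ lim_I])
    show "(\<lambda>t. norm A * M * w 0 t) integrable_on {0..1}"
      using has_integral_mult_right[OF w_int[of 0]] by blast
  qed (use bound lim_f in auto)
  then show ?thesis
    unfolding has_contour_integral_linepath g_def .
qed (simp add: gen_pseries_def)

text \<open>
  Order \<open>\<nu>\<close> multiplies the coefficient of \<open>z powr p\<close> by \<open>\<Gamma>(p + 1) / \<Gamma>(p + 1 - \<nu>)\<close>, which is 0 at the
  poles of the denominator.
\<close>
definition frac_deriv_coeffs :: "real \<Rightarrow> real \<Rightarrow> real \<Rightarrow> (nat \<Rightarrow> complex) \<Rightarrow> nat \<Rightarrow> complex" where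
  "frac_deriv_coeffs \<nu> q b a k =
     of_real (Gamma (q + 1 + real k * b) * rGamma (q + 1 + real k * b - \<nu>)) * a k"

text \<open>The falling factorial of p equals \<Gamma>(p + 1) times the reciprocal Gamma function at
  p + 1 - n. With \<open>rGamma\<close> this also covers the integers p < n, where both sides are
  0.\<close>

lemma higher_deriv_gen_pseries_frac:
  assumes a: "entire_coeffs a" and z: "z \<notin> \<real>\<^sub>\<le>\<^sub>0" and q: "q > -1" and b: "b > 0"
  shows "(deriv ^^ n) (gen_pseries q b a) z = gen_pseries (q - real n) b (frac_deriv_coeffs (real n) q b a) z"
proof -
  have "pochhammer (q + real k * b + 1 - real n) n =
      Gamma (q + 1 + real k * b) * rGamma (q + 1 + real k * b - real n)" for k
  proof -
    have "q + real k * b + 1 > 0" using exponent_shift_pos[OF q b, of k] by linarith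
    then show ?thesis
      using pochhammer_rGamma[of "q + real k * b + 1 - real n" n] Gamma_real_pos[of "q + real k * b + 1"]
      by (simp add: rGamma_inverse_Gamma field_simps del: Gamma_real_pos)
  qed
  then show ?thesis
    using higher_deriv_gen_pseries[OF a z] by (simp add: frac_deriv_coeffs_def[abs_def])
qed

lemma nonint_order:
  assumes "\<nu> \<notin> \<nat>"
  shows "real (nat \<lceil>\<nu>\<rceil>) - \<nu> > 0"
proof -
  have "\<nu> \<le> real (nat \<lceil>\<nu>\<rceil>)" by (rule real_nat_ceiling_ge)
  moreover have "\<nu> \<noteq> real (nat \<lceil>\<nu>\<rceil>)" using assms by (metis of_nat_in_Nats)
  ultimately show ?thesis by simp
qed

text \<open>The integral of order \<mu> multiplies by \<Gamma>(p + 1) / \<Gamma>(p + 1 + \<mu>), the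
  n derivatives then by \<Gamma>(p + 1 + \<mu>) / \<Gamma>(p + 1 - \<nu>), and the middle value
  cancels. Integrability at 0 asks for p > -1.\<close>

lemma has_RL_derivative_gen_pseries:
  assumes a: "entire_coeffs a" and z: "z \<notin> \<real>\<^sub>\<le>\<^sub>0" and q: "q > -1" and b: "b > 0" and \<nu>: "\<nu> > 0"
  shows "has_RL_derivative (gen_pseries q b a) \<nu> z
    (gen_pseries (q - \<nu>) b (frac_deriv_coeffs \<nu> q b a) z)"
proof (cases "\<nu> \<in> \<nat>")
  case True
  then obtain n where "\<nu> = real n" by (auto elim: Nats_cases)
  then show ?thesis
    using higher_deriv_gen_pseries_frac[OF a z q b, of n] by (simp add: has_RL_derivative_def)
next
  case False
  define n where "n = nat \<lceil>\<nu>\<rceil>"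
  define \<mu> where "\<mu> = real n - \<nu>"
  have \<mu>: "\<mu> > 0" using nonint_order[OF False] by (simp add: \<mu>_def n_def)
  define d where "d k = of_real (Gamma (q + 1 + real k * b) / Gamma (q + 1 + real k * b + \<mu>)) * a k" for k
  have d: "entire_coeffs d"
    unfolding d_def by (intro entire_coeffs_Gamma_ratio a b \<mu>)
  have "(deriv ^^ n) (gen_pseries (q + \<mu>) b d) z =
      gen_pseries (q + \<mu> - real n) b (frac_deriv_coeffs (real n) (q + \<mu>) b d) z"
    using q \<mu> by (intro higher_deriv_gen_pseries_frac d z b) auto
  also have "frac_deriv_coeffs (real n) (q + \<mu>) b d = frac_deriv_coeffs \<nu> q b a"
  proof
    fix k
    have "q + 1 + real k * b > 0" by (rule exponent_shift_pos[OF q b])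
    then have "Gamma (q + 1 + real k * b + \<mu>) > 0" using \<mu> by simp
    moreover have eqs: "q + \<mu> + 1 + real k * b = q + 1 + real k * b + \<mu>"
       "q + 1 + real k * b + \<mu> - real n = q + 1 + real k * b - \<nu>" by (simp_all add: \<mu>_def)
    ultimately show "frac_deriv_coeffs (real n) (q + \<mu>) b d k = frac_deriv_coeffs \<nu> q b a k"
      unfolding frac_deriv_coeffs_def d_def eqs by simp
  qed
  also have "q + \<mu> - real n = q - \<nu>" by (simp add: \<mu>_def)
  finally have D: "gen_pseries (q - \<nu>) b (frac_deriv_coeffs \<nu> q b a) z = (deriv ^^ n) (gen_pseries (q + \<mu>) b d) z" ..
  have I: "((\<lambda>u. (x - u) powr of_real (\<mu> - 1) * gen_pseries q b a u) has_contour_integral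
     of_real (Gamma \<mu>) * gen_pseries (q + \<mu>) b d x) (linepath 0 x)" for x
    using fractional_integral_gen_pseries[OF a q b \<mu>] by (simp add: d_def[abs_def])
  have "Gamma \<mu> \<noteq> 0" using Gamma_real_pos[OF \<mu>] by simp
  then show ?thesis
    unfolding has_RL_derivative_def Let_def n_def[symmetric] \<mu>_def[symmetric]
    using False I D holomorphic_gen_pseries[OF d]
    by (auto intro!: exI[of _ "gen_pseries (q + \<mu>) b d"] exI[of _ "of_real (Gamma \<mu>) * gen_pseries (q + \<mu>) b d _"])
qed

text \<open>Here the n derivatives come before the integral. They lower the first exponent to q - n,
  and \<open>qn\<close> keeps it above -1, so that the integral converges at 0.\<close>

lemma has_caputo_derivative_gen_pseries:
  assumes a: "entire_coeffs a" and z: "z \<notin> \<real>\<^sub>\<le>\<^sub>0" and b: "b > 0" and \<nu>: "\<nu> > 0" and q: "q > -1"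
    and qn: "\<nu> \<in> \<nat> \<or> q > of_int \<lceil>\<nu>\<rceil> - 1"
  shows "has_caputo_derivative (gen_pseries q b a) \<nu> z
    (gen_pseries (q - \<nu>) b (frac_deriv_coeffs \<nu> q b a) z)"
proof (cases "\<nu> \<in> \<nat>")
  case True
  then obtain n where "\<nu> = real n" by (auto elim: Nats_cases)
  then show ?thesis
    using higher_deriv_gen_pseries_frac[OF a z q b, of n] by (simp add: has_caputo_derivative_def)
next
  case False
  define n where "n = nat \<lceil>\<nu>\<rceil>"
  define \<mu> where "\<mu> = real n - \<nu>"
  have \<mu>: "\<mu> > 0" using nonint_order[OF False] by (simp add: \<mu>_def n_def)
  have qn: "q - real n > -1" using qn False \<nu> by (simp add: n_def)
  define d where "d = (\<lambda>k. of_real (pochhammer (q + real k * b + 1 - real n) n) * a k)"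
  have d: "entire_coeffs d" unfolding d_def by (rule entire_coeffs_mult_pochhammer[OF a])
  have deriv_eq: "(deriv ^^ n) (gen_pseries q b a) u = gen_pseries (q - real n) b d u"
    if "u \<notin> \<real>\<^sub>\<le>\<^sub>0" for u
    using higher_deriv_gen_pseries[OF a that] by (simp add: d_def)
  define J where "J = gen_pseries (q - real n + \<mu>) b
    (\<lambda>k. of_real (Gamma (q - real n + 1 + real k * b) / Gamma (q - real n + 1 + real k * b + \<mu>)) * d k) z"
  have J: "J = gen_pseries (q - \<nu>) b (frac_deriv_coeffs \<nu> q b a) z"
  proof -
    have "of_real (Gamma (q - real n + 1 + real k * b) / Gamma (q - real n + 1 + real k * b + \<mu>)) * d k =
       frac_deriv_coeffs \<nu> q b a k" for k
    proof -
      have pos: "q - real n + 1 + real k * b > 0" by (rule exponent_shift_pos[OF qn b])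
      then have "q - real n + 1 + real k * b \<notin> \<int>\<^sub>\<le>\<^sub>0" by (auto elim!: nonpos_Ints_cases)
      then have "pochhammer (q + real k * b + 1 - real n) n =
         Gamma (q + 1 + real k * b) / Gamma (q - real n + 1 + real k * b)"
        using pochhammer_Gamma[of "q - real n + 1 + real k * b" n] by (simp add: algebra_simps)
      moreover have "Gamma (q - real n + 1 + real k * b) \<noteq> 0" using Gamma_real_pos[OF pos] by linarith
      moreover have eq: "q - real n + 1 + real k * b + \<mu> = q + 1 + real k * b - \<nu>"
        by (simp add: \<mu>_def)
      ultimately show ?thesis
        unfolding d_def frac_deriv_coeffs_def eq by (simp add: rGamma_inverse_Gamma divide_inverse)
    qed
    then show ?thesis unfolding J_def by (simp add: \<mu>_def)
  qed
  have "((\<lambda>u. (z - u) powr of_real (\<mu> - 1) * gen_pseries (q - real n) b d u) has_contour_integral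
     of_real (Gamma \<mu>) * J) (linepath 0 z)"
    unfolding J_def by (rule fractional_integral_gen_pseries[OF d qn b \<mu>])
  then have I: "((\<lambda>u. (z - u) powr of_real (\<mu> - 1) * (deriv ^^ n) (gen_pseries q b a) u) has_contour_integral
     of_real (Gamma \<mu>) * J) (linepath 0 z)"
    unfolding has_contour_integral_linepath
  \<comment> \<open>The formula for the n-th derivative holds off the cut, and t = 0 is the only
    parameter whose point on the segment lies on it.\<close>
  proof (rule has_integral_spike_finite[rotated 2])
    fix t :: real assume t: "t \<in> {0..1} - {0}"
    then have "linepath 0 z t \<notin> \<real>\<^sub>\<le>\<^sub>0"
      using z by (auto simp: linepath_def complex_nonpos_Reals_iff mult_le_0_iff)
    then show "(z - linepath 0 z t) powr of_real (\<mu> - 1) * (deriv ^^ n) (gen_pseries q b a) (linepath 0 z t) * (z - 0) =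
      (z - linepath 0 z t) powr of_real (\<mu> - 1) * gen_pseries (q - real n) b d (linepath 0 z t) * (z - 0)"
      by (simp add: deriv_eq)
  qed simp
  have "Gamma \<mu> \<noteq> 0" using Gamma_real_pos[OF \<mu>] by simp
  then show ?thesis
    unfolding has_caputo_derivative_def Let_def n_def[symmetric] \<mu>_def[symmetric] J[symmetric]
    using False I by (auto intro!: exI[of _ "of_real (Gamma \<mu>) * J"])
qed

text \<open>Serves \<open>\<kappa>_fun\<close>, a difference of two series in steps of 2/lam whose
  exponents are offset by 1/lam.\<close>

lemma has_RL_derivative_diff:
  assumes "f holomorphic_on (- \<real>\<^sub>\<le>\<^sub>0)" "g holomorphic_on (- \<real>\<^sub>\<le>\<^sub>0)" and z: "z \<notin> \<real>\<^sub>\<le>\<^sub>0"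
    and f: "has_RL_derivative f \<nu> z D" and g: "has_RL_derivative g \<nu> z E"
  shows "has_RL_derivative (\<lambda>x. f x - g x) \<nu> z (D - E)"
proof (cases "\<nu> \<in> \<nat>")
  case True
  then show ?thesis
    using f g z higher_deriv_diff[OF assms(1,2), of z] by (simp add: has_RL_derivative_def open_Compl)
next
  case False
  define n where "n = nat \<lceil>\<nu>\<rceil>"
  from f False obtain F where F: "F holomorphic_on (- \<real>\<^sub>\<le>\<^sub>0)" "D = (deriv ^^ n) F z"
    "\<And>x. x \<in> - \<real>\<^sub>\<le>\<^sub>0 \<Longrightarrow> \<exists>I. ((\<lambda>u. (x - u) powr of_real (real n - \<nu> - 1) * f u) has_contour_integral I) (linepath 0 x) \<and>
               F x = I / of_real (Gamma (real n - \<nu>))"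
    unfolding has_RL_derivative_def Let_def n_def by auto
  from g False obtain H where H: "H holomorphic_on (- \<real>\<^sub>\<le>\<^sub>0)" "E = (deriv ^^ n) H z"
    "\<And>x. x \<in> - \<real>\<^sub>\<le>\<^sub>0 \<Longrightarrow> \<exists>I. ((\<lambda>u. (x - u) powr of_real (real n - \<nu> - 1) * g u) has_contour_integral I) (linepath 0 x) \<and>
               H x = I / of_real (Gamma (real n - \<nu>))"
    unfolding has_RL_derivative_def Let_def n_def by auto
  have "\<exists>I. ((\<lambda>u. (x - u) powr of_real (real n - \<nu> - 1) * (f u - g u)) has_contour_integral I) (linepath 0 x) \<and>
               F x - H x = I / of_real (Gamma (real n - \<nu>))" if x: "x \<in> - \<real>\<^sub>\<le>\<^sub>0" for x
  proof -
    obtain I J where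
      "((\<lambda>u. (x - u) powr of_real (real n - \<nu> - 1) * f u) has_contour_integral I) (linepath 0 x)"
      "F x = I / of_real (Gamma (real n - \<nu>))"
      "((\<lambda>u. (x - u) powr of_real (real n - \<nu> - 1) * g u) has_contour_integral J) (linepath 0 x)"
      "H x = J / of_real (Gamma (real n - \<nu>))"
      using F(3)[OF x] H(3)[OF x] by blast
    then show ?thesis
      by (intro exI[of _ "I - J"]) (auto simp: right_diff_distrib diff_divide_distrib intro: has_contour_integral_diff)
  qed
  moreover have "D - E = (deriv ^^ n) (\<lambda>x. F x - H x) z"
    using higher_deriv_diff[OF F(1) H(1), of z n] z F(2) H(2) by (simp add: open_Compl)
  ultimately show ?thesis
    unfolding has_RL_derivative_def Let_def n_def[symmetric]
    using False F(1) H(1) by (auto intro!: exI[of _ "\<lambda>x. F x - H x"] holomorphic_intros)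
qed

lemma has_caputo_derivative_diff:
  assumes "f holomorphic_on (- \<real>\<^sub>\<le>\<^sub>0)" "g holomorphic_on (- \<real>\<^sub>\<le>\<^sub>0)" and z: "z \<notin> \<real>\<^sub>\<le>\<^sub>0"
    and f: "has_caputo_derivative f \<nu> z D" and g: "has_caputo_derivative g \<nu> z E"
  shows "has_caputo_derivative (\<lambda>x. f x - g x) \<nu> z (D - E)"
proof (cases "\<nu> \<in> \<nat>")
  case True
  then show ?thesis
    using f g z higher_deriv_diff[OF assms(1,2), of z] by (simp add: has_caputo_derivative_def open_Compl)
next
  case False
  define n where "n = nat \<lceil>\<nu>\<rceil>"
  let ?P = "\<lambda>f u. (z - u) powr of_real (real n - \<nu> - 1) * (deriv ^^ n) f u"
  from f g False obtain I J where I: "(?P f has_contour_integral I) (linepath 0 z)"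
    "D = I / of_real (Gamma (real n - \<nu>))" and J: "(?P g has_contour_integral J) (linepath 0 z)"
    "E = J / of_real (Gamma (real n - \<nu>))"
    unfolding has_caputo_derivative_def Let_def n_def by auto
  have "(?P (\<lambda>x. f x - g x) has_contour_integral (I - J)) (linepath 0 z)"
    using has_contour_integral_diff[OF I(1) J(1)]
    unfolding has_contour_integral_linepath
  proof (rule has_integral_spike_finite[rotated 2])
    fix t :: real assume t: "t \<in> {0..1} - {0}"
    then have "linepath 0 z t \<in> - \<real>\<^sub>\<le>\<^sub>0"
      using z by (auto simp: linepath_def complex_nonpos_Reals_iff mult_le_0_iff)
    then show "?P (\<lambda>x. f x - g x) (linepath 0 z t) * (z - 0) =
      (?P f (linepath 0 z t) - ?P g (linepath 0 z t)) * (z - 0)"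
      by (subst higher_deriv_diff[OF assms(1,2)]) (auto simp: algebra_simps)
  qed simp
  then show ?thesis
    unfolding has_caputo_derivative_def Let_def n_def[symmetric]
    using False I(2) J(2) by (auto intro!: exI[of _ "I - J"] simp: diff_divide_distrib)
qed

section \<open>The coefficient triangle\<close>

text \<open>The ratio test in product form, which admits vanishing coefficients.\<close>

lemma entire_coeffs_ratio:
  assumes r: "r \<longlonglongrightarrow> (0::real)" and le: "\<And>k. norm (a (Suc k)) \<le> r k * norm (a k)"
  shows "entire_coeffs a"
  unfolding entire_coeffs_def
proof
  fix R :: real
  have "(\<lambda>k. r k * \<bar>R\<bar>) \<longlonglongrightarrow> 0" using tendsto_mult_left_zero[OF r] by simp
  then have "eventually (\<lambda>k. r k * \<bar>R\<bar> < 1 / 2) sequentially"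
    by (rule order_tendstoD) simp
  then obtain N where N: "\<And>k. k \<ge> N \<Longrightarrow> r k * \<bar>R\<bar> < 1 / 2"
    by (auto simp: eventually_sequentially)
  show "summable (\<lambda>k. norm (a k) * R ^ k)"
  proof (rule summable_ratio_test[of "1 / 2" N])
    fix k assume k: "N \<le> k"
    have "norm (norm (a (Suc k)) * R ^ Suc k) = norm (a (Suc k)) * (\<bar>R\<bar> * \<bar>R\<bar> ^ k)"
      by (simp add: abs_mult power_abs)
    also have "\<dots> \<le> (r k * norm (a k)) * (\<bar>R\<bar> * \<bar>R\<bar> ^ k)"
      by (intro mult_right_mono le) simp
    also have "\<dots> = (r k * \<bar>R\<bar>) * (norm (a k) * \<bar>R\<bar> ^ k)" by simp
    also have "\<dots> \<le> 1 / 2 * (norm (a k) * \<bar>R\<bar> ^ k)"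
      using N[OF k] by (intro mult_right_mono) auto
    finally show "norm (norm (a (Suc k)) * R ^ Suc k) \<le> 1 / 2 * norm (norm (a k) * R ^ k)"
      by (simp add: abs_mult power_abs)
  qed simp
qed

section \<open>Mittag-Leffler series\<close>

lemma entire_coeffs_mittag_leffler:
  assumes "\<alpha> > 0" "\<beta> > 0"
  shows "entire_coeffs (\<lambda>k. 1 / of_real (Gamma (\<beta> + real k * \<alpha>)))"
proof (rule entire_coeffs_ratio[OF Gamma_ratio_seq_tendsto_0[OF assms(1,1), of \<beta>]])
  fix k
  have pos: "Gamma (\<beta> + real j * \<alpha>) > 0" for j using assms by (intro Gamma_real_pos add_pos_nonneg) auto
  have eq: "\<beta> + real (Suc k) * \<alpha> = \<beta> + real k * \<alpha> + \<alpha>" by (simp add: algebra_simps)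
  show "norm (1 / of_real (Gamma (\<beta> + real (Suc k) * \<alpha>)) :: complex) \<le>
      Gamma (\<beta> + real k * \<alpha>) / Gamma (\<beta> + real k * \<alpha> + \<alpha>) *
      norm (1 / of_real (Gamma (\<beta> + real k * \<alpha>)) :: complex)"
    using pos[of k] pos[of "Suc k"] unfolding eq by (simp add: norm_divide)
qed

lemma mittag_leffler_sums:
  assumes "\<alpha> > 0" "\<beta> > 0"
  shows "(\<lambda>k. z ^ k / of_real (Gamma (\<alpha> * real k + \<beta>))) sums mittag_leffler \<alpha> \<beta> z"
  unfolding mittag_leffler_def
  using entire_coeffs_summable[OF entire_coeffs_mittag_leffler[OF assms], of z]
  by (intro summable_sums) (simp add: mult.commute add.commute)

text \<open>Terms of even and odd index are grouped in pairs. In this way the functions of order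
  2/lam in the equations for G(z, w) and G(w, z) merge into one of order 1/lam.\<close>

lemma mittag_leffler_even_odd:
  assumes "\<alpha> > 0" "\<beta> > 0"
  shows "mittag_leffler \<alpha> \<beta> z =
    mittag_leffler (2 * \<alpha>) \<beta> (z\<^sup>2) + z * mittag_leffler (2 * \<alpha>) (\<beta> + \<alpha>) (z\<^sup>2)"
proof -
  define f where "f k = z ^ k / of_real (Gamma (\<alpha> * real k + \<beta>))" for k
  have "(\<lambda>n. sum f {n * 2..<n * 2 + 2}) sums mittag_leffler \<alpha> \<beta> z"
    using sums_group[OF mittag_leffler_sums[OF assms], of 2] unfolding f_def[abs_def] by simp
  moreover have "sum f {n * 2..<n * 2 + 2} =
     (z\<^sup>2) ^ n / of_real (Gamma (2 * \<alpha> * real n + \<beta>)) +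
     z * ((z\<^sup>2) ^ n / of_real (Gamma (2 * \<alpha> * real n + (\<beta> + \<alpha>))))" for n
  proof -
    have "{n * 2..<n * 2 + 2} = {2 * n, Suc (2 * n)}" by auto
    then show ?thesis by (simp add: f_def power_mult power2_eq_square power_mult_distrib algebra_simps)
  qed
  moreover have "(\<lambda>n. (z\<^sup>2) ^ n / of_real (Gamma (2 * \<alpha> * real n + \<beta>)) +
     z * ((z\<^sup>2) ^ n / of_real (Gamma (2 * \<alpha> * real n + (\<beta> + \<alpha>))))) sums
     (mittag_leffler (2 * \<alpha>) \<beta> (z\<^sup>2) + z * mittag_leffler (2 * \<alpha>) (\<beta> + \<alpha>) (z\<^sup>2))"
    using assms by (intro sums_add sums_mult mittag_leffler_sums) auto
  ultimately show ?thesis by (simp add: sums_unique2)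
qed

lemma infsum_nat_eq_suminf:
  fixes f :: "nat \<Rightarrow> 'a::banach"
  shows "summable (\<lambda>k. norm (f k)) \<Longrightarrow> infsum f UNIV = suminf f"
  by (metis infsumI norm_summable_imp_has_sum summable_norm_cancel summable_sums)

lemma suminf_shift_powser:
  fixes a :: "nat \<Rightarrow> complex"
  assumes "entire_coeffs a"
  shows "(\<lambda>k. (case k of 0 \<Rightarrow> 0 | Suc j \<Rightarrow> a j) * x ^ k) sums (x * (\<Sum>k. a k * x ^ k))"
proof -
  have "(\<lambda>k. x * (a k * x ^ k)) sums (x * (\<Sum>k. a k * x ^ k))"
    by (intro sums_mult summable_sums entire_coeffs_summable[OF assms])
  then have "(\<lambda>k. (case Suc k of 0 \<Rightarrow> 0 | Suc j \<Rightarrow> a j) * x ^ Suc k) sums (x * (\<Sum>k. a k * x ^ k))"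
    by (simp add: mult_ac)
  from sums_Suc_imp[OF _ this] show ?thesis by simp
qed

section \<open>Coefficients of the skew-orthogonal polynomials and their decay\<close>

locale origin_scaling =
  fixes lam c :: real
  assumes lam_pos: "lam > 0" and c_gt: "c > -1"
begin

text \<open>The quotient \<open>coef (Suc k) l / coef k l\<close> for k = j, the same in all columns
  l \<le> j. These are also the factors of the Kilbas--Saigo coefficients.\<close>

definition ratio :: "nat \<Rightarrow> real" where
  "ratio j = Gamma ((2 * real j + 3 + c) / lam) / Gamma ((2 * real j + 4 + c) / lam)"

text \<open>
  Up to powers of \<open>N\<close>, the coefficient of \<open>\<eta> ^ (2 * l)\<close> in \<open>q\<^sub>2\<^sub>k(\<eta>) / s\<^sub>k\<close> is \<open>lam / 2 * coef k l\<close>.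
\<close>
definition coef :: "nat \<Rightarrow> nat \<Rightarrow> real" where
  "coef k l = (if l \<le> k
     then (\<Prod>j=l..<k. Gamma ((2 * real j + 3 + c) / lam) / Gamma ((2 * real j + 2 + c) / lam))
       / Gamma ((2 * real k + 2 + c) / lam)
     else 0)"

lemma Gamma_pos: "x \<ge> 1 \<Longrightarrow> Gamma ((x + c) / lam) > 0"
  using lam_pos c_gt by (intro Gamma_real_pos divide_pos_pos) auto

lemma coef_diag: "coef k k = 1 / Gamma ((2 * real k + 2 + c) / lam)"
  by (simp add: coef_def)

lemma coef_upper: "k < l \<Longrightarrow> coef k l = 0"
  by (simp add: coef_def)

lemma coef_nonneg: "coef k l \<ge> 0"
  unfolding coef_def
  by (auto intro!: divide_nonneg_nonneg prod_nonneg less_imp_le[OF Gamma_pos])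

lemma ratio_pos: "ratio j > 0"
  unfolding ratio_def by (intro divide_pos_pos Gamma_pos) auto

lemma coef_Suc_left:
  assumes "l \<le> k"
  shows "coef (Suc k) l = coef k l * ratio k"
proof -
  have "Gamma ((2 * real k + 2 + c) / lam) > 0" by (rule Gamma_pos) simp
  moreover have "2 * real (Suc k) + 2 + c = 2 * real k + 4 + c" by simp
  ultimately show ?thesis
    using assms unfolding coef_def ratio_def by (simp only:) (simp add: field_simps)
qed

lemma coef_Suc_right:
  assumes "l < k"
  shows "coef k l = Gamma ((2 * real l + 3 + c) / lam) / Gamma ((2 * real l + 2 + c) / lam) * coef k (Suc l)"
  using assms by (simp add: coef_def prod.atLeast_Suc_lessThan)

lemma ratio_tendsto_0: "ratio \<longlonglongrightarrow> 0"
proof -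
  have "(\<lambda>k. Gamma ((3 + c) / lam + real k * (2 / lam)) / Gamma ((3 + c) / lam + real k * (2 / lam) + 1 / lam)) \<longlonglongrightarrow> 0"
    using lam_pos by (intro Gamma_ratio_seq_tendsto_0) auto
  moreover have "(3 + c) / lam + real k * (2 / lam) = (2 * real k + 3 + c) / lam"
    "(3 + c) / lam + real k * (2 / lam) + 1 / lam = (2 * real k + 4 + c) / lam" for k
    by (simp_all add: add_divide_distrib)
  ultimately show ?thesis by (simp only: ratio_def[abs_def])
qed

text \<open>For l \<le> k, \<open>coef k l / coef l l\<close> is the product of
  \<open>ratio j\<close> over l \<le> j < k, and all but finitely many of these factors are below
  \<delta>. The exceptional ones go into \<open>C\<close>, uniformly in \<open>l\<close>.\<close>

lemma coef_le:
  assumes \<delta>: "\<delta> > 0"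
  shows "\<exists>C\<ge>0. \<forall>k l. coef k l \<le> C * \<delta> ^ k * (coef l l / \<delta> ^ l)"
proof -
  \<comment> \<open>The excess of \<open>ratio j\<close> over \<delta>, cut off at 1 so that the
    products \<open>P\<close> never decrease. They are constant from \<open>J\<close> on, and
    \<open>P J\<close> becomes the constant \<open>C\<close>.\<close>
  define u where "u j = max 1 (ratio j / \<delta>)" for j
  define P where "P k = (\<Prod>j<k. u j)" for k
  have u1: "u j \<ge> 1" for j by (simp add: u_def)
  have Ppos: "P k > 0" for k by (auto simp: P_def intro!: prod_pos less_le_trans[OF zero_less_one u1])
  have P_mono: "P j \<le> P k" if "j \<le> k" for j k
    using that
  proof (induction k rule: dec_induct)
    case (step n)
    have "P n * 1 \<le> P n * u n" by (intro mult_left_mono u1 less_imp_le[OF Ppos])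
    then show ?case using step by (simp add: P_def)
  qed simp
  have "eventually (\<lambda>j. ratio j < \<delta>) sequentially"
    using ratio_tendsto_0 \<delta> by (rule order_tendstoD)
  then obtain J where J: "\<And>j. j \<ge> J \<Longrightarrow> ratio j < \<delta>" by (auto simp: eventually_sequentially)
  have P_le: "P k \<le> P J" for k
  proof (cases "k \<le> J")
    case False
    then have "J \<le> k" by simp
    then have "P k = P J"
    proof (induction k rule: dec_induct)
      case (step n)
      then have "u n = 1" using J[of n] \<delta> by (simp add: u_def)
      then show ?case using step by (simp add: P_def)
    qed simp
    then show ?thesis by simp
  qed (rule P_mono)
  have "coef k l \<le> P J * \<delta> ^ k * (coef l l / \<delta> ^ l)" for k l
  proof (cases "l \<le> k")
    case True
    then have "coef k l * P l \<le> P k * \<delta> ^ k * (coef l l / \<delta> ^ l)"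
    proof (induction k rule: dec_induct)
      case base then show ?case using \<delta> by simp
    next
      case (step n)
      have "ratio n \<le> u n * \<delta>" using \<delta> by (simp add: u_def max_def field_simps)
      then have "(coef n l * P l) * ratio n \<le> (P n * \<delta> ^ n * (coef l l / \<delta> ^ l)) * (u n * \<delta>)"
        by (rule mult_mono[OF step.IH])
          (use ratio_pos[of n] \<delta> coef_nonneg[of l l] Ppos[of n] in \<open>simp_all add: less_imp_le\<close>)
      then show ?case using step.hyps by (simp add: coef_Suc_left P_def mult_ac)
    qed
    moreover have "coef k l \<le> coef k l * P l"
      using P_mono[of 0 l] coef_nonneg[of k l] by (simp add: P_def mult_le_cancel_left1)
    moreover have "P k * \<delta> ^ k * (coef l l / \<delta> ^ l) \<le> P J * \<delta> ^ k * (coef l l / \<delta> ^ l)"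
      using P_le coef_nonneg \<delta> by (intro mult_right_mono) auto
    ultimately show ?thesis by linarith
  next
    case False
    then show ?thesis using coef_nonneg[of l l] Ppos[of J] \<delta> by (simp add: coef_upper less_imp_le)
  qed
  then show ?thesis using Ppos[of J] by (intro exI[of _ "P J"]) auto
qed

lemma entire_coeffs_diag: "entire_coeffs (\<lambda>l. of_real (coef l l))"
proof -
  have "(2 + c) / lam + real k * (2 / lam) = (2 * real k + 2 + c) / lam" for k
    by (simp add: add_divide_distrib)
  moreover have "entire_coeffs (\<lambda>k. 1 / of_real (Gamma ((2 + c) / lam + real k * (2 / lam))))"
    using lam_pos c_gt by (intro entire_coeffs_mittag_leffler) auto
  ultimately show ?thesis by (simp only: coef_diag of_real_divide of_real_1)
qed

text \<open>A majorant that factors into a part in \<open>k\<close> and a part in \<open>l\<close>.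
  The choice \<delta> = 1 / (2 (R + 1)) gives \<delta> R \<le> 1/2, and dividing the diagonal by
  \<delta>^l preserves infinite radius.\<close>

lemma coef_double_bound:
  assumes R: "R \<ge> 0"
  obtains C D where "\<And>k l. coef k l * R ^ k \<le> C * (1 / 2) ^ k * D l" "entire_coeffs (\<lambda>l. of_real (D l))"
    "\<And>l. D l \<ge> 0" "C \<ge> 0"
proof -
  define \<delta> where "\<delta> = 1 / (2 * (R + 1))"
  have \<delta>: "\<delta> > 0" "\<delta> * R \<le> 1 / 2" using R by (auto simp: \<delta>_def field_simps)
  from coef_le[OF \<delta>(1)] obtain C where C: "C \<ge> 0" "\<And>k l. coef k l \<le> C * \<delta> ^ k * (coef l l / \<delta> ^ l)"
    by blast
  show ?thesis
  proof (rule that)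
    fix k l
    have "coef k l * R ^ k \<le> C * \<delta> ^ k * (coef l l / \<delta> ^ l) * R ^ k"
      using R by (intro mult_right_mono C) auto
    also have "\<dots> = C * (\<delta> * R) ^ k * (coef l l / \<delta> ^ l)" by (simp add: power_mult_distrib)
    also have "\<dots> \<le> C * (1 / 2) ^ k * (coef l l / \<delta> ^ l)"
      using \<delta> R C coef_nonneg by (intro mult_right_mono mult_left_mono power_mono) auto
    finally show "coef k l * R ^ k \<le> C * (1 / 2) ^ k * (coef l l / \<delta> ^ l)" .
    show "entire_coeffs (\<lambda>l. of_real (coef l l / \<delta> ^ l))"
      by (rule entire_coeffs_bound[OF entire_coeffs_diag, of _ 1 "1 / \<delta>"])
         (use \<delta> coef_nonneg in \<open>auto simp: norm_divide norm_power power_divide\<close>)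
  qed (use \<delta> coef_nonneg C in auto)
qed

text \<open>In the double series of \<open>coef k l\<close> x^k y^l, \<open>row y k\<close> is the
  coefficient of x^k, a finite sum because the coefficients are triangular, and
  \<open>col x l\<close> below is the coefficient of y^l, an infinite one.\<close>

definition row :: "complex \<Rightarrow> nat \<Rightarrow> complex" where
  "row y k = (\<Sum>l\<le>k. of_real (coef k l) * y ^ l)"

definition col :: "complex \<Rightarrow> nat \<Rightarrow> complex" where
  "col x l = (\<Sum>k. of_real (coef k l) * x ^ k)"

lemma coef_summable_on:
  "(\<lambda>(k, l). of_real (coef k l) * x ^ k * y ^ l) summable_on (UNIV \<times> UNIV)" for x y :: complex
proof -
  obtain C D where CD: "\<And>k l. coef k l * norm x ^ k \<le> C * (1 / 2) ^ k * D l"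
    "entire_coeffs (\<lambda>l. of_real (D l))" "\<And>l. D l \<ge> 0" "C \<ge> 0"
    using coef_double_bound[of "norm x"] norm_ge_zero by blast
  have D: "summable (\<lambda>l. D l * norm y ^ l)"
    using CD(2,3) by (auto simp: entire_coeffs_def)
  define S where "S = (\<Sum>l. D l * norm y ^ l)"
  have "(\<lambda>(k, l). (C * (1 / 2) ^ k) * (D l * norm y ^ l)) summable_on (UNIV \<times> UNIV)"
  proof (rule summable_on_SigmaI)
    show "((\<lambda>l. case (k, l) of (k, l) \<Rightarrow> (C * (1 / 2) ^ k) * (D l * norm y ^ l)) has_sum (C * (1 / 2) ^ k * S)) UNIV" for k
      using D CD(3) unfolding S_def prod.case
      by (intro has_sum_cmult_right sums_nonneg_imp_has_sum) (auto simp: summable_sums)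
    have "summable (\<lambda>k. C * (1 / 2) ^ k * S)"
      by (intro summable_mult2 summable_mult summable_geometric) auto
    moreover have "S \<ge> 0" unfolding S_def using D CD(3) by (intro suminf_nonneg) auto
    ultimately show "(\<lambda>k. C * (1 / 2) ^ k * S) summable_on UNIV"
      using CD(4) by (intro summable_nonneg_imp_summable_on) auto
  qed (use CD in auto)
  then have "(\<lambda>p. norm (case p of (k, l) \<Rightarrow> of_real (coef k l) * x ^ k * y ^ l)) summable_on (UNIV \<times> UNIV)"
  proof (rule Infinite_Sum.abs_summable_on_comparison_test')
    fix p :: "nat \<times> nat"
    obtain k l where p: "p = (k, l)" by (cases p)
    show "norm (case p of (k, l) \<Rightarrow> of_real (coef k l) * x ^ k * y ^ l) \<le>
      (case p of (k, l) \<Rightarrow> (C * (1 / 2) ^ k) * (D l * norm y ^ l))"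
      using mult_right_mono[OF CD(1)[of k l], of "norm y ^ l"] coef_nonneg[of k l]
      by (simp add: p norm_mult norm_power mult_ac)
  qed
  then show ?thesis by (rule abs_summable_summable)
qed

text \<open>From the diagonal downwards every column is a constant multiple of the products of
  \<open>ratio\<close>.\<close>

lemma entire_coeffs_column: "entire_coeffs (\<lambda>k. of_real (coef k l))"
proof (rule entire_coeffs_bound[of "\<lambda>k. of_real (\<Prod>j<k. ratio j)"])
  show "entire_coeffs (\<lambda>k. of_real (\<Prod>j<k. ratio j))"
    by (rule entire_coeffs_ratio[OF ratio_tendsto_0])
       (simp add: norm_mult ratio_pos less_imp_le)
next
  fix k
  have pos: "(\<Prod>j<k. ratio j) > 0" for k by (intro prod_pos) (simp add: ratio_pos)
  have "coef k l = coef l l / (\<Prod>j<l. ratio j) * (\<Prod>j<k. ratio j)" if "l \<le> k"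
    using that
  proof (induction k rule: dec_induct)
    case base then show ?case using pos[of l] by (metis less_irrefl nonzero_eq_divide_eq)
  qed (simp add: coef_Suc_left)
  then have "coef k l \<le> coef l l / (\<Prod>j<l. ratio j) * (\<Prod>j<k. ratio j)"
    using coef_nonneg[of l l] pos[of l] pos[of k]
    by (cases "l \<le> k") (auto simp: coef_upper)
  then show "norm (of_real (coef k l) :: complex) \<le>
     coef l l / (\<Prod>j<l. ratio j) * 1 ^ k * norm (of_real (\<Prod>j<k. ratio j) :: complex)"
    using pos[of k] coef_nonneg[of k l] by (simp del: of_real_prod)
qed simp

lemma entire_coeffs_row: "entire_coeffs (row y)"
  unfolding entire_coeffs_def
proof
  fix R :: real
  obtain C D where CD: "\<And>k l. coef k l * \<bar>R\<bar> ^ k \<le> C * (1 / 2) ^ k * D l"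
    "entire_coeffs (\<lambda>l. of_real (D l))" "\<And>l. D l \<ge> 0" "C \<ge> 0"
    using coef_double_bound[of "\<bar>R\<bar>"] abs_ge_zero by blast
  have D: "summable (\<lambda>l. D l * norm y ^ l)"
    using CD(2,3) by (auto simp: entire_coeffs_def)
  define S where "S = (\<Sum>l. D l * norm y ^ l)"
  have "summable (\<lambda>k. C * (1 / 2) ^ k * S)"
    by (intro summable_mult2 summable_mult summable_geometric) auto
  then show "summable (\<lambda>k. norm (row y k) * R ^ k)"
  proof (rule summable_comparison_test')
    fix k
    have "norm (norm (row y k) * R ^ k) = norm (row y k) * \<bar>R\<bar> ^ k"
      by (simp add: abs_mult power_abs)
    also have "\<dots> \<le> (\<Sum>l\<le>k. coef k l * norm y ^ l) * \<bar>R\<bar> ^ k"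
      unfolding row_def
      by (intro mult_right_mono sum_norm_le) (auto simp: norm_mult norm_power coef_nonneg)
    also have "\<dots> = (\<Sum>l\<le>k. (coef k l * \<bar>R\<bar> ^ k) * norm y ^ l)"
      by (simp add: sum_distrib_right sum_distrib_left mult_ac)
    also have "\<dots> \<le> (\<Sum>l\<le>k. (C * (1 / 2) ^ k * D l) * norm y ^ l)"
      by (intro sum_mono mult_right_mono CD) auto
    also have "\<dots> = C * (1 / 2) ^ k * (\<Sum>l\<le>k. D l * norm y ^ l)"
      by (simp add: sum_distrib_left mult_ac)
    also have "\<dots> \<le> C * (1 / 2) ^ k * S"
      unfolding S_def using D CD(3,4) by (intro mult_left_mono sum_le_suminf) auto
    finally show "norm (norm (row y k) * R ^ k) \<le> C * (1 / 2) ^ k * S" .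
  qed
qed

lemma entire_coeffs_col: "entire_coeffs (col x)"
proof -
  obtain C D where CD: "\<And>k l. coef k l * norm x ^ k \<le> C * (1 / 2) ^ k * D l"
    "entire_coeffs (\<lambda>l. of_real (D l))" "\<And>l. D l \<ge> 0" "C \<ge> 0"
    using coef_double_bound[of "norm x"] norm_ge_zero by blast
  show ?thesis
  proof (rule entire_coeffs_bound[OF CD(2), of _ "2 * C" 1])
    fix l
    have sm: "summable (\<lambda>k. norm (of_real (coef k l) * x ^ k))"
      by (rule entire_coeffs_summable_norm[OF entire_coeffs_column])
    have "norm (col x l) \<le> (\<Sum>k. norm (of_real (coef k l) * x ^ k))"
      unfolding col_def by (rule summable_norm[OF sm])
    also have "\<dots> \<le> (\<Sum>k. C * D l * (1 / 2) ^ k)"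
    proof (rule suminf_le[OF _ sm])
      show "norm (of_real (coef k l) * x ^ k) \<le> C * D l * (1 / 2) ^ k" for k
        using CD(1)[of k l] coef_nonneg[of k l] by (simp add: norm_mult norm_power mult_ac)
      show "summable (\<lambda>k. C * D l * (1 / 2) ^ k)" by (intro summable_mult summable_geometric) simp
    qed
    also have "\<dots> = C * D l * 2"
      using suminf_mult[OF summable_geometric, of "1 / 2 :: real" "C * D l"] suminf_geometric[of "1 / 2 :: real"] by simp
    finally show "norm (col x l) \<le> 2 * C * 1 ^ l * norm (of_real (D l) :: complex)"
      using CD(3)[of l] by simp
  qed simp
qed

text \<open>Fubini for an absolutely summable double series. Rows exhibit the sum as entire in
  \<open>x\<close>, columns as entire in \<open>y\<close>.\<close>

lemma row_col_swap: "(\<Sum>k. row y k * x ^ k) = (\<Sum>l. col x l * y ^ l)"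
proof -
  define F where "F k l = of_real (coef k l) * x ^ k * y ^ l" for k l
  have "infsum (\<lambda>k. infsum (F k) UNIV) UNIV = infsum (\<lambda>l. infsum (\<lambda>k. F k l) UNIV) UNIV"
    using coef_summable_on unfolding F_def by (rule infsum_swap_banach)
  moreover have "infsum (F k) UNIV = row y k * x ^ k" for k
    by (intro infsumI has_sum_finite_neutralI[of "{..k}"])
       (auto simp: F_def coef_upper row_def sum_distrib_left sum_distrib_right mult_ac)
  moreover have "infsum (\<lambda>k. F k l) UNIV = col x l * y ^ l" for l
  proof -
    have sm: "summable (\<lambda>k. norm (of_real (coef k l) * x ^ k))"
      by (rule entire_coeffs_summable_norm[OF entire_coeffs_column])
    have "infsum (\<lambda>k. F k l) UNIV = infsum (\<lambda>k. of_real (coef k l) * x ^ k) UNIV * y ^ l"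
      unfolding F_def by (rule infsum_cmult_left')
    then show ?thesis by (simp add: infsum_nat_eq_suminf[OF sm] col_def)
  qed
  moreover have "infsum (\<lambda>k. row y k * x ^ k) UNIV = (\<Sum>k. row y k * x ^ k)"
    by (intro infsum_nat_eq_suminf entire_coeffs_summable_norm entire_coeffs_row)
  moreover have "infsum (\<lambda>l. col x l * y ^ l) UNIV = (\<Sum>l. col x l * y ^ l)"
    by (intro infsum_nat_eq_suminf entire_coeffs_summable_norm entire_coeffs_col)
  ultimately show ?thesis by simp
qed

section \<open>The fractional differential equations\<close>

definition T_sum :: "complex \<Rightarrow> complex \<Rightarrow> complex" where
  "T_sum x y = (\<Sum>k. row y k * x ^ k)"

text \<open>Collects the products of q_(2k+1) in the first variable and q_(2k) in the second. Under
  z -> sqrt(2/lam) z^lam and with the factor (z w)^(lam - 1), the exponents become 2 k + 1 + c and 2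
  l + c.\<close>

definition G_fun :: "complex \<Rightarrow> complex \<Rightarrow> complex" where
  "G_fun z w = z powr of_real ((2 + c) / lam - 1) * w powr of_real ((1 + c) / lam - 1) *
     T_sum (z powr of_real (2 / lam)) (w powr of_real (2 / lam))"

lemma G_fun_left:
  "(\<lambda>z. G_fun z w) = gen_pseries ((2 + c) / lam - 1) (2 / lam)
     (\<lambda>k. w powr of_real ((1 + c) / lam - 1) * row (w powr of_real (2 / lam)) k)"
  by (rule ext) (simp only: gen_pseries_cmult[OF entire_coeffs_row] G_fun_def gen_pseries_def T_sum_def mult_ac)

text \<open>In the second variable the expansion is by columns, and its lowest exponent is smaller
  by 1/lam than the one in the first variable.\<close>

lemma G_fun_right:
  "(\<lambda>z. G_fun w z) = gen_pseries ((1 + c) / lam - 1) (2 / lam)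
     (\<lambda>l. w powr of_real ((2 + c) / lam - 1) * col (w powr of_real (2 / lam)) l)"
  unfolding gen_pseries_cmult[OF entire_coeffs_col, abs_def] G_fun_def gen_pseries_def T_sum_def row_col_swap
  by (simp only: mult_ac)

text \<open>Every power that occurs is a monomial in \<open>p\<close> and \<open>u\<close>, up to
  inverses, so the later identities become algebra in a few letters.\<close>

lemma exponents:
  fixes z :: complex
  assumes "z \<noteq> 0"
  defines "p \<equiv> z powr of_real (1 / lam)" and "u \<equiv> z powr of_real ((1 + c) / lam - 1)"
  shows "z powr of_real (2 / lam) = p\<^sup>2" "z powr of_real ((2 + c) / lam - 1) = u * p"
    "z powr of_real ((2 + c) / lam - 1 - 1 / lam) = u"
    "z powr of_real ((1 + c) / lam - 1 - 1 / lam) = u / p" "p \<noteq> 0"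
proof -
  have e: "2 / lam = 1 / lam + 1 / lam" "(2 + c) / lam - 1 = (1 + c) / lam - 1 + 1 / lam"
    "(2 + c) / lam - 1 - 1 / lam = (1 + c) / lam - 1"
    by (simp_all add: add_divide_distrib)
  show "z powr of_real (2 / lam) = p\<^sup>2" "z powr of_real ((2 + c) / lam - 1) = u * p"
    "z powr of_real ((2 + c) / lam - 1 - 1 / lam) = u"
    "z powr of_real ((1 + c) / lam - 1 - 1 / lam) = u / p" "p \<noteq> 0"
    using assms(1) unfolding p_def u_def e(1) e(3)
    by (simp_all only: e(2) of_real_add of_real_diff powr_add powr_diff power2_eq_square powr_eq_0_iff not_False_eq_True)
qed

text \<open>For k = j + 1 the factor on the left is 1 / \<open>ratio j\<close>, which undoes the
  passage from row \<open>j\<close> to row \<open>j + 1\<close>. The diagonal entry has no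
  predecessor and leaves the Mittag-Leffler coefficient.\<close>

lemma row_recurrence:
  "of_real (Gamma ((2 * real k + 2 + c) / lam) * rGamma ((2 * real k + 1 + c) / lam)) * row y k =
     (case k of 0 \<Rightarrow> 0 | Suc j \<Rightarrow> row y j) + y ^ k / of_real (Gamma ((2 * real k + 1 + c) / lam))"
proof (cases k)
  case 0
  have "Gamma ((2 + c) / lam) > 0" by (rule Gamma_pos) simp
  then show ?thesis using 0 by (simp add: row_def coef_diag rGamma_inverse_Gamma field_simps)
next
  case (Suc j)
  define g where "g = Gamma ((2 * real j + 3 + c) / lam)"
  define h where "h = Gamma ((2 * real j + 4 + c) / lam)"
  have pos: "g > 0" "h > 0" unfolding g_def h_def by (auto intro!: Gamma_pos)
  have eqs: "2 * real (Suc j) + 2 + c = 2 * real j + 4 + c" "2 * real (Suc j) + 1 + c = 2 * real j + 3 + c"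
    by simp_all
  have "row y (Suc j) = (\<Sum>l\<le>j. of_real (coef j l * ratio j) * y ^ l) + of_real (1 / h) * y ^ Suc j"
    unfolding row_def by (simp add: coef_Suc_left coef_diag[of "Suc j", unfolded eqs] h_def)
  also have "(\<Sum>l\<le>j. of_real (coef j l * ratio j) * y ^ l) = of_real (ratio j) * row y j"
    by (simp add: row_def sum_distrib_left mult_ac)
  also have "ratio j = g / h" by (simp add: ratio_def g_def h_def)
  finally have row: "row y (Suc j) = of_real (g / h) * row y j + of_real (1 / h) * y ^ Suc j" .
  have rg: "rGamma ((2 * real j + 3 + c) / lam) = 1 / g"
    by (simp add: rGamma_inverse_Gamma g_def divide_inverse)
  show ?thesis
    unfolding Suc eqs rg row g_def[symmetric] h_def[symmetric] using pos by (simp add: field_simps)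
qed

text \<open>The factor on the left is the one relating \<open>coef k (Suc l)\<close> to
  \<open>coef k l\<close> for l < k. At k = l the former is 0 and the latter is not, which accounts
  for the subtracted term.\<close>

lemma col_recurrence:
  "of_real (Gamma ((2 * real (Suc l) + 1 + c) / lam) * rGamma ((2 * real (Suc l) + c) / lam)) * col x (Suc l) =
     col x l - x ^ l / of_real (Gamma ((2 * real l + 2 + c) / lam))"
proof -
  define \<gamma> where "\<gamma> = Gamma ((2 * real l + 3 + c) / lam) / Gamma ((2 * real l + 2 + c) / lam)"
  have eqs: "2 * real (Suc l) + c = 2 * real l + 2 + c" "2 * real (Suc l) + 1 + c = 2 * real l + 3 + c"
    by simp_all
  have "(\<lambda>k. of_real \<gamma> * (of_real (coef k (Suc l)) * x ^ k)) sums (of_real \<gamma> * col x (Suc l))"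
    unfolding col_def
    by (intro sums_mult summable_sums entire_coeffs_summable entire_coeffs_column)
  moreover have "(\<lambda>k. of_real (coef k l) * x ^ k - (if k = l then of_real (coef l l) * x ^ l else 0)) sums
      (col x l - of_real (coef l l) * x ^ l)"
    unfolding col_def
    by (intro sums_diff sums_single[of l "\<lambda>k. of_real (coef l l) * x ^ l", simplified] summable_sums entire_coeffs_summable entire_coeffs_column)
  moreover have "of_real \<gamma> * (of_real (coef k (Suc l)) * x ^ k) =
     of_real (coef k l) * x ^ k - (if k = l then of_real (coef l l) * x ^ l else 0)" for k
  proof -
    consider "k < l" | "k = l" | "k > l" by linarith
    then show ?thesis
    proof cases
      case 3
      then show ?thesis by (simp add: coef_Suc_right[of l k] \<gamma>_def)
    qed (simp_all add: coef_upper)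
  qed
  ultimately have "of_real \<gamma> * col x (Suc l) = col x l - of_real (coef l l) * x ^ l"
    by (simp add: sums_unique2)
  then show ?thesis unfolding eqs \<gamma>_def by (simp add: rGamma_inverse_Gamma divide_inverse coef_diag mult_ac)
qed

text \<open>The parameters 1/lam, 2 and 3 + c - lam are those for which the j-th factor of the
  Kilbas--Saigo coefficient is \<open>ratio j\<close>; the first column consists of the products of
  these factors, divided by \<Gamma>((2 + c)/lam).\<close>

lemma col_0_kilbas_saigo:
  "col x 0 = kilbas_saigo (1 / lam) 2 (3 + c - lam) x / of_real (Gamma ((2 + c) / lam))"
proof -
  have r: "Gamma (1 / lam * (real j * 2 + (3 + c - lam)) + 1) / Gamma (1 / lam * (real j * 2 + (3 + c - lam) + 1) + 1) = ratio j" for j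
  proof -
    have "1 / lam * (real j * 2 + (3 + c - lam)) + 1 = (2 * real j + 3 + c) / lam"
      "1 / lam * (real j * 2 + (3 + c - lam) + 1) + 1 = (2 * real j + 4 + c) / lam"
      using lam_pos by (simp_all add: field_simps)
    then show ?thesis by (simp only: ratio_def)
  qed
  have cf: "coef k 0 = (\<Prod>j<k. ratio j) / Gamma ((2 + c) / lam)" for k
    by (induction k) (simp_all add: coef_diag coef_Suc_left)
  have sm: "summable (\<lambda>k. of_real (\<Prod>j<k. ratio j) * x ^ k)"
  proof (rule entire_coeffs_summable)
    show "entire_coeffs (\<lambda>k. of_real (\<Prod>j<k. ratio j))"
      by (rule entire_coeffs_ratio[OF ratio_tendsto_0]) (simp add: norm_mult ratio_pos less_imp_le)
  qed
  have "kilbas_saigo (1 / lam) 2 (3 + c - lam) x = 1 + (\<Sum>k. of_real (\<Prod>j<Suc k. ratio j) * x ^ Suc k)"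
    unfolding kilbas_saigo_def r by (simp only: mult.commute)
  also have "\<dots> = (\<Sum>k. of_real (\<Prod>j<k. ratio j) * x ^ k)"
    using suminf_split_head[OF sm] by simp
  finally show ?thesis
    unfolding col_def cf using suminf_divide[OF sm, of "of_real (Gamma ((2 + c) / lam))"] by simp
qed

text \<open>In the notation of \<open>exponents\<close>, lowering the exponents by 1/lam changes the
  prefactor u p into u, and the shift of rows contributes x = p^2. Then u p^2 = p (u p) reproduces
  z^(1/lam) times \<open>G_fun\<close>.\<close>

lemma frac_deriv_G_left:
  assumes "z \<noteq> 0"
  shows "gen_pseries ((2 + c) / lam - 1 - 1 / lam) (2 / lam)
     (frac_deriv_coeffs (1 / lam) ((2 + c) / lam - 1) (2 / lam)
       (\<lambda>k. w powr of_real ((1 + c) / lam - 1) * row (w powr of_real (2 / lam)) k)) z = rhs_G lam c G_fun z w"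
proof -
  define x y where "x = z powr of_real (2 / lam)" and "y = w powr of_real (2 / lam)"
  define W where "W = w powr of_real ((1 + c) / lam - 1)"
  have e: "(2 + c) / lam - 1 + 1 + real k * (2 / lam) = (2 * real k + 2 + c) / lam"
    "(2 + c) / lam - 1 + 1 + real k * (2 / lam) - 1 / lam = (2 * real k + 1 + c) / lam"
    "2 / lam * real k + (1 + c) / lam = (2 * real k + 1 + c) / lam" for k
    using lam_pos by (simp_all add: field_simps)
  have fd: "frac_deriv_coeffs (1 / lam) ((2 + c) / lam - 1) (2 / lam) (\<lambda>k. W * row y k) k * x ^ k =
     W * ((case k of 0 \<Rightarrow> 0 | Suc j \<Rightarrow> row y j) * x ^ k + (x * y) ^ k / of_real (Gamma (2 / lam * real k + (1 + c) / lam)))" for k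
  proof -
    have "frac_deriv_coeffs (1 / lam) ((2 + c) / lam - 1) (2 / lam) (\<lambda>k. W * row y k) k =
      W * (of_real (Gamma ((2 * real k + 2 + c) / lam) * rGamma ((2 * real k + 1 + c) / lam)) * row y k)"
      unfolding frac_deriv_coeffs_def e(2) unfolding e(1) by simp
    then show ?thesis unfolding row_recurrence e by (simp add: power_mult_distrib algebra_simps)
  qed
  have "(\<lambda>k. W * ((case k of 0 \<Rightarrow> 0 | Suc j \<Rightarrow> row y j) * x ^ k + (x * y) ^ k / of_real (Gamma (2 / lam * real k + (1 + c) / lam)))) sums
    (W * (x * T_sum x y + mittag_leffler (2 / lam) ((1 + c) / lam) (x * y)))"
    unfolding T_sum_def using lam_pos c_gt
    by (intro sums_mult sums_add suminf_shift_powser entire_coeffs_row mittag_leffler_sums) auto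
  then have S: "(\<Sum>k. frac_deriv_coeffs (1 / lam) ((2 + c) / lam - 1) (2 / lam) (\<lambda>k. W * row y k) k * x ^ k) =
    W * (x * T_sum x y + mittag_leffler (2 / lam) ((1 + c) / lam) (x * y))"
    unfolding fd by (simp add: sums_iff)
  have "gen_pseries ((2 + c) / lam - 1 - 1 / lam) (2 / lam)
     (frac_deriv_coeffs (1 / lam) ((2 + c) / lam - 1) (2 / lam) (\<lambda>k. W * row y k)) z =
     z powr of_real ((1 + c) / lam - 1) * (W * (x * T_sum x y + mittag_leffler (2 / lam) ((1 + c) / lam) (x * y)))"
    unfolding gen_pseries_def x_def[symmetric] S exponents(3)[OF assms] ..
  also have "\<dots> = rhs_G lam c G_fun z w"
  proof -
    have x: "x = z powr of_real (1 / lam) * z powr of_real (1 / lam)"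
      unfolding x_def exponents(1)[OF assms] power2_eq_square ..
    show ?thesis
      unfolding rhs_G_def pow_mult_def G_fun_def x_def[symmetric] y_def[symmetric] W_def[symmetric] exponents(2)[OF assms]
      by (simp only: distrib_left mult_ac) (simp only: x mult_ac)
  qed
  finally show ?thesis unfolding W_def y_def .
qed

text \<open>The derivative of order 1/lam in z of G(w, z). The Mittag-Leffler term comes from the
  diagonal, the Kilbas--Saigo term from l = 0.\<close>

definition rhs_G_swapped :: "complex \<Rightarrow> complex \<Rightarrow> complex" where
  "rhs_G_swapped z w = z powr of_real (1 / lam) * G_fun w z
     - pow_mult z w ((2 + c) / lam - 1) * mittag_leffler (2 / lam) ((2 + c) / lam) (pow_mult z w (2 / lam))
     + of_real (Gamma ((1 + c) / lam) / (Gamma (c / lam) * Gamma ((2 + c) / lam)))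
       * pow_mult z w ((1 + c) / lam - 1) * pow_div w z (1 / lam)
       * kilbas_saigo (1 / lam) 2 (3 + c - lam) (w powr of_real (2 / lam))"

text \<open>Entries with l \<ge> 1 are shifted to l - 1 by \<open>col_recurrence\<close>. The entry
  l = 0 cannot be shifted and survives with the power z^(c/lam - 1) and the first column as
  coefficient.\<close>

lemma frac_deriv_G_right:
  assumes z: "z \<noteq> 0" and w: "w \<noteq> 0"
  shows "gen_pseries ((1 + c) / lam - 1 - 1 / lam) (2 / lam)
     (frac_deriv_coeffs (1 / lam) ((1 + c) / lam - 1) (2 / lam)
       (\<lambda>l. w powr of_real ((2 + c) / lam - 1) * col (w powr of_real (2 / lam)) l)) z = rhs_G_swapped z w"
proof -
  define x y where "x = z powr of_real (2 / lam)" and "y = w powr of_real (2 / lam)"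
  define W where "W = w powr of_real ((2 + c) / lam - 1)"
  define g0 where "g0 = Gamma ((1 + c) / lam) / Gamma (c / lam)"
  define M where "M = mittag_leffler (2 / lam) ((2 + c) / lam) (x * y)"
  have e: "(1 + c) / lam - 1 + 1 + real k * (2 / lam) = (2 * real k + 1 + c) / lam"
    "(1 + c) / lam - 1 + 1 + real k * (2 / lam) - 1 / lam = (2 * real k + c) / lam"
    "2 / lam * real k + (2 + c) / lam = (2 * real k + 2 + c) / lam" for k
    using lam_pos by (simp_all add: field_simps)
  let ?F = "frac_deriv_coeffs (1 / lam) ((1 + c) / lam - 1) (2 / lam) (\<lambda>l. W * col y l)"
  have F: "?F l = W * (of_real (Gamma ((2 * real l + 1 + c) / lam) * rGamma ((2 * real l + c) / lam)) * col y l)" for l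
    unfolding frac_deriv_coeffs_def e(2) unfolding e(1) by simp
  have fd: "?F (Suc l) * x ^ Suc l = W * x * (col y l * x ^ l - (x * y) ^ l / of_real (Gamma (2 / lam * real l + (2 + c) / lam)))" for l
    unfolding F col_recurrence e by (simp add: power_mult_distrib algebra_simps)
  \<comment> \<open>If c/lam is a pole of Gamma, this term vanishes: there \<open>rGamma\<close> and
    division by \<open>Gamma\<close> both give 0.\<close>
  have F0: "?F 0 = W * (of_real g0 * col y 0)"
    unfolding F by (simp add: g0_def rGamma_inverse_Gamma divide_inverse)
  have "(\<lambda>l. W * x * (col y l * x ^ l - (x * y) ^ l / of_real (Gamma (2 / lam * real l + (2 + c) / lam)))) sums
    (W * x * (T_sum y x - M))"
    unfolding T_sum_def row_col_swap M_def using lam_pos c_gt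
    by (intro sums_mult sums_diff summable_sums entire_coeffs_summable entire_coeffs_col mittag_leffler_sums) auto
  then have "(\<lambda>l. ?F (Suc l) * x ^ Suc l) sums (W * x * (T_sum y x - M))"
    unfolding fd .
  from sums_Suc[OF this] have "(\<Sum>l. ?F l * x ^ l) = W * x * (T_sum y x - M) + W * (of_real g0 * col y 0)"
    by (simp add: sums_iff F0)
  then have S: "(\<Sum>l. ?F l * x ^ l) = W * x * (T_sum y x - M) +
      W * (of_real g0 * (kilbas_saigo (1 / lam) 2 (3 + c - lam) y / of_real (Gamma ((2 + c) / lam))))"
    unfolding col_0_kilbas_saigo .
  define p u where "p = z powr of_real (1 / lam)" and "u = z powr of_real ((1 + c) / lam - 1)"
  define q v where "q = w powr of_real (1 / lam)" and "v = w powr of_real ((1 + c) / lam - 1)"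
  \<comment> \<open>\<open>g2\<close> stands for \<Gamma>(c/lam), which HOL sets to 0 at a pole; by
    the conventions on division by 0 the identity holds there as well.\<close>
  have alg: "u / p * (v * q * p\<^sup>2 * (T - M) + v * q * (g1 / g2 * (K / g3))) =
     p * (v * q * u * T) - (u * p) * (v * q) * M + g1 / (g2 * g3) * (u * v) * (q / p) * K"
    if "p \<noteq> 0" for p u v q T M g1 g2 g3 K :: complex
    using that by (cases "g2 = 0"; cases "g3 = 0"; simp add: field_simps power2_eq_square)
  have Wx: "W = v * q" "x = p\<^sup>2"
    unfolding W_def v_def q_def x_def p_def exponents[OF z] exponents[OF w] by auto
  have "gen_pseries ((1 + c) / lam - 1 - 1 / lam) (2 / lam) ?F z =
      u / p * (v * q * p\<^sup>2 * (T_sum y x - M) + v * q * (of_real (Gamma ((1 + c) / lam)) / of_real (Gamma (c / lam)) *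
        (kilbas_saigo (1 / lam) 2 (3 + c - lam) y / of_real (Gamma ((2 + c) / lam)))))"
    unfolding gen_pseries_def x_def[symmetric] S exponents(4)[OF z] u_def[symmetric] p_def[symmetric]
    unfolding g0_def of_real_divide Wx ..
  also have "\<dots> = rhs_G_swapped z w"
  proof -
    have "p \<noteq> 0" unfolding p_def by (rule exponents(5)[OF z])
    have "pow_mult z w (2 / lam) = x * y" "pow_mult z w ((2 + c) / lam - 1) = (u * p) * (v * q)"
      "pow_mult z w ((1 + c) / lam - 1) = u * v" "pow_div w z (1 / lam) = q / p" "G_fun w z = v * q * u * T_sum y x"
      unfolding pow_mult_def pow_div_def G_fun_def x_def[symmetric] y_def[symmetric] exponents(2)[OF z] exponents(2)[OF w]
        p_def u_def q_def v_def by auto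
    then show ?thesis
      unfolding alg[OF \<open>p \<noteq> 0\<close>] rhs_G_swapped_def M_def y_def[symmetric] p_def[symmetric]
      by (simp only: of_real_divide of_real_mult)
  qed
  finally show ?thesis unfolding W_def y_def .
qed

definition \<kappa>_fun :: "complex \<Rightarrow> complex \<Rightarrow> complex" where
  "\<kappa>_fun z w = G_fun z w - G_fun w z"

text \<open>Subtraction makes the Mittag-Leffler term of \<open>rhs_G_swapped\<close> positive. With
  its extra factor p = (z w)^(1/lam) it is the odd half, and the term of \<open>rhs_G\<close> the
  even half, of a single series in p.\<close>

lemma rhs_\<kappa>_eq:
  assumes z: "z \<noteq> 0" and w: "w \<noteq> 0"
  shows "rhs_G lam c G_fun z w - rhs_G_swapped z w = rhs_\<kappa> lam c \<kappa>_fun z w"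
proof -
  define p where "p = pow_mult z w (1 / lam)"
  have "pow_mult z w (2 / lam) = p\<^sup>2"
    unfolding p_def pow_mult_def exponents[OF z] exponents[OF w] by (rule power_mult_distrib[symmetric])
  moreover have "pow_mult z w ((2 + c) / lam - 1) = pow_mult z w ((1 + c) / lam - 1) * p"
    unfolding p_def pow_mult_def exponents[OF z] exponents[OF w] by (simp only: mult_ac)
  moreover have "mittag_leffler (1 / lam) ((1 + c) / lam) p =
    mittag_leffler (2 / lam) ((1 + c) / lam) (p\<^sup>2) + p * mittag_leffler (2 / lam) ((2 + c) / lam) (p\<^sup>2)"
    using mittag_leffler_even_odd[of "1 / lam" "(1 + c) / lam" p] lam_pos c_gt
    by (simp add: add_divide_distrib[symmetric] add.commute)
  ultimately show ?thesis
    unfolding rhs_G_def rhs_G_swapped_def rhs_\<kappa>_def p_def[symmetric] \<kappa>_fun_def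
    by (simp add: algebra_simps)
qed

lemma G_fun_holomorphic: "holomorphic_in_both G_fun (- \<real>\<^sub>\<le>\<^sub>0)"
  unfolding holomorphic_in_both_def
proof (intro conjI ballI)
  show "(\<lambda>z. G_fun z w) holomorphic_on - \<real>\<^sub>\<le>\<^sub>0" for w
    unfolding G_fun_left by (intro holomorphic_gen_pseries entire_coeffs_cmult entire_coeffs_row)
  show "(\<lambda>w. G_fun z w) holomorphic_on - \<real>\<^sub>\<le>\<^sub>0" for z
    unfolding G_fun_right by (intro holomorphic_gen_pseries entire_coeffs_cmult entire_coeffs_col)
qed

lemma exponents_gt: "(2 + c) / lam - 1 > -1" "(1 + c) / lam - 1 > -1" "2 / lam > 0" "1 / lam > 0"
  using lam_pos c_gt by simp_all

lemma G_fun_RL: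
  assumes z: "z \<notin> \<real>\<^sub>\<le>\<^sub>0"
  shows "has_RL_derivative (\<lambda>x. G_fun x w) (1 / lam) z (rhs_G lam c G_fun z w)"
proof -
  have "z \<noteq> 0" using z by auto
  show ?thesis
    unfolding G_fun_left frac_deriv_G_left[OF \<open>z \<noteq> 0\<close>, symmetric]
    by (intro has_RL_derivative_gen_pseries entire_coeffs_cmult entire_coeffs_row z exponents_gt)
qed

lemma G_fun_RL_right:
  assumes z: "z \<notin> \<real>\<^sub>\<le>\<^sub>0" and w: "w \<notin> \<real>\<^sub>\<le>\<^sub>0"
  shows "has_RL_derivative (\<lambda>x. G_fun w x) (1 / lam) z (rhs_G_swapped z w)"
proof -
  have "z \<noteq> 0" "w \<noteq> 0" using z w by auto
  show ?thesis
    unfolding G_fun_right frac_deriv_G_right[OF \<open>z \<noteq> 0\<close> \<open>w \<noteq> 0\<close>, symmetric]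
    by (intro has_RL_derivative_gen_pseries entire_coeffs_cmult entire_coeffs_col z exponents_gt)
qed

lemma G_fun_caputo:
  assumes z: "z \<notin> \<real>\<^sub>\<le>\<^sub>0" and "1 / lam \<in> \<nat> \<or> of_int \<lceil>1 / lam\<rceil> < (2 + c) / lam"
  shows "has_caputo_derivative (\<lambda>x. G_fun x w) (1 / lam) z (rhs_G lam c G_fun z w)"
proof -
  have "z \<noteq> 0" using z by auto
  have "1 / lam \<in> \<nat> \<or> (2 + c) / lam - 1 > of_int \<lceil>1 / lam\<rceil> - 1" using assms(2) by linarith
  then show ?thesis
    unfolding G_fun_left frac_deriv_G_left[OF \<open>z \<noteq> 0\<close>, symmetric]
    by (intro has_caputo_derivative_gen_pseries entire_coeffs_cmult entire_coeffs_row z exponents_gt)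
qed

lemma G_fun_caputo_right:
  assumes z: "z \<notin> \<real>\<^sub>\<le>\<^sub>0" and w: "w \<notin> \<real>\<^sub>\<le>\<^sub>0"
    and "1 / lam \<in> \<nat> \<or> of_int \<lceil>1 / lam\<rceil> < (1 + c) / lam"
  shows "has_caputo_derivative (\<lambda>x. G_fun w x) (1 / lam) z (rhs_G_swapped z w)"
proof -
  have "z \<noteq> 0" "w \<noteq> 0" using z w by auto
  have "1 / lam \<in> \<nat> \<or> (1 + c) / lam - 1 > of_int \<lceil>1 / lam\<rceil> - 1" using assms(3) by linarith
  then show ?thesis
    unfolding G_fun_right frac_deriv_G_right[OF \<open>z \<noteq> 0\<close> \<open>w \<noteq> 0\<close>, symmetric]
    by (intro has_caputo_derivative_gen_pseries entire_coeffs_cmult entire_coeffs_col z exponents_gt)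
qed

lemma \<kappa>_fun_RL:
  assumes z: "z \<notin> \<real>\<^sub>\<le>\<^sub>0" and w: "w \<notin> \<real>\<^sub>\<le>\<^sub>0"
  shows "has_RL_derivative (\<lambda>x. \<kappa>_fun x w) (1 / lam) z (rhs_\<kappa> lam c \<kappa>_fun z w)"
proof -
  have "rhs_G lam c G_fun z w - rhs_G_swapped z w = rhs_\<kappa> lam c \<kappa>_fun z w"
    using z w by (intro rhs_\<kappa>_eq) auto
  then show ?thesis
    using has_RL_derivative_diff[OF _ _ z G_fun_RL[OF z] G_fun_RL_right[OF z w], of w]
      G_fun_holomorphic w by (simp add: holomorphic_in_both_def \<kappa>_fun_def)
qed

text \<open>The part G(w, z) has the smaller lowest exponent in z, so its condition implies the one
  for G(z, w).\<close>

lemma \<kappa>_fun_caputo: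
  assumes z: "z \<notin> \<real>\<^sub>\<le>\<^sub>0" and w: "w \<notin> \<real>\<^sub>\<le>\<^sub>0"
    and order: "1 / lam \<in> \<nat> \<or> of_int \<lceil>1 / lam\<rceil> < (1 + c) / lam"
  shows "has_caputo_derivative (\<lambda>x. \<kappa>_fun x w) (1 / lam) z (rhs_\<kappa> lam c \<kappa>_fun z w)"
proof -
  have "(1 + c) / lam < (2 + c) / lam" using lam_pos by (simp add: divide_strict_right_mono)
  then have order': "1 / lam \<in> \<nat> \<or> of_int \<lceil>1 / lam\<rceil> < (2 + c) / lam" using order by linarith
  have "rhs_G lam c G_fun z w - rhs_G_swapped z w = rhs_\<kappa> lam c \<kappa>_fun z w"
    using z w by (intro rhs_\<kappa>_eq) auto
  then show ?thesis
    using has_caputo_derivative_diff[OF _ _ z G_fun_caputo[OF z order'] G_fun_caputo_right[OF z w order], of w]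
      G_fun_holomorphic w by (simp add: holomorphic_in_both_def \<kappa>_fun_def)
qed

end

text \<open>The bound keeps a Ln z inside the strip where the principal logarithm inverts exp. This
  is where the sector in \<open>limit_prekernel\<close> enters.\<close>

lemma powr_powr_complex:
  fixes z :: complex
  assumes "z \<noteq> 0" "\<bar>a * Arg z\<bar> < pi"
  shows "(z powr of_real a) powr of_real b = z powr of_real (a * b)"
proof -
  have "Im (of_real a * Ln z) = a * Arg z" by (simp add: Arg_eq_Im_Ln assms(1))
  then have "Ln (exp (of_real a * Ln z)) = of_real a * Ln z"
    using assms(2) by (intro Ln_exp) auto
  then show ?thesis using assms(1) by (simp add: powr_def mult_ac)
qed

lemma norm_matrix_2_le:
  fixes A :: "complex^2^2"
  shows "norm A \<le> norm (A $ 1 $ 1) + norm (A $ 1 $ 2) + norm (A $ 2 $ 1) + norm (A $ 2 $ 2)"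
proof -
  have "norm (v :: 'a::real_normed_vector^2) \<le> norm (v $ 1) + norm (v $ 2)" for v
    using L2_set_le_sum[of UNIV "\<lambda>i. norm (v $ i)"] by (simp add: norm_vec_def sum_2)
  from this[of A] this[of "A $ 1"] this[of "A $ 2"] show ?thesis by linarith
qed

context origin_scaling
begin

section \<open>Convergence of the rescaled kernel\<close>

text \<open>This constant has three roles: \<open>r_scale lam N\<close> is \<sigma> N^(-1/(2 lam)),
  the number sqrt(2/lam) raised to 1/lam is \<sigma>, and \<sigma> is the prefactor of the limiting
  pre-kernel.\<close>

definition \<sigma> :: real where
  "\<sigma> = (2 / lam) powr (1 / (2 * lam))"

text \<open>What remains once the powers of r = \<open>r_scale lam N\<close> have cancelled: lam/2
  comes from the inverse skew-norm, the powers of \<sigma> from N = (\<sigma> / r)^(2 lam).\<close>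

definition amplitude :: real where
  "amplitude = \<sigma> powr (2 * c) * \<sigma> ^ 4 * (lam / 2)"

text \<open>The pre-kernel freed from constants. It and its limit \<open>\<Phi>\<close> are entire
  in each variable, so all branching of the limit comes from the factor (z w)^c.\<close>

definition \<Phi>_part :: "nat \<Rightarrow> complex \<Rightarrow> complex \<Rightarrow> complex" where
  "\<Phi>_part N z w = z * (\<Sum>k<N. row ((of_real \<sigma>)\<^sup>2 * w\<^sup>2) k * ((of_real \<sigma>)\<^sup>2 * z\<^sup>2) ^ k)
     - w * (\<Sum>k<N. row ((of_real \<sigma>)\<^sup>2 * z\<^sup>2) k * ((of_real \<sigma>)\<^sup>2 * w\<^sup>2) ^ k)"

definition \<Phi> :: "complex \<Rightarrow> complex \<Rightarrow> complex" where
  "\<Phi> z w = z * T_sum ((of_real \<sigma>)\<^sup>2 * z\<^sup>2) ((of_real \<sigma>)\<^sup>2 * w\<^sup>2)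
     - w * T_sum ((of_real \<sigma>)\<^sup>2 * w\<^sup>2) ((of_real \<sigma>)\<^sup>2 * z\<^sup>2)"

lemma \<sigma>_pos: "\<sigma> > 0"
  using lam_pos by (simp add: \<sigma>_def)

text \<open>As the coefficients are nonnegative, \<open>row y k\<close> is largest in modulus on the
  disc at y = R, so one evaluation supplies the majorant.\<close>

lemma T_partial_sums_uniform:
  "uniform_limit (cball 0 R \<times> cball 0 R) (\<lambda>N (x, y). \<Sum>k<N. row y k * x ^ k) (\<lambda>(x, y). T_sum x y) sequentially"
proof -
  define M where "M k = norm (row (of_real R) k) * R ^ k" for k
  have "uniform_limit (cball 0 R \<times> cball 0 R) (\<lambda>N p. \<Sum>k<N. row (snd p) k * fst p ^ k)
      (\<lambda>p. \<Sum>k. row (snd p) k * fst p ^ k) sequentially"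
  proof (rule Weierstrass_m_test)
    show "summable M" using entire_coeffs_row[of "of_real R"] by (simp add: entire_coeffs_def M_def[abs_def])
    fix k and p :: "complex \<times> complex"
    assume "p \<in> cball 0 R \<times> cball 0 R"
    then have p: "norm (fst p) \<le> R" "norm (snd p) \<le> R" by auto
    then have R: "R \<ge> 0" using norm_ge_zero order_trans by blast
    have "norm (row (snd p) k) \<le> (\<Sum>l\<le>k. coef k l * R ^ l)"
      unfolding row_def
      by (intro sum_norm_le)
         (auto simp: norm_mult norm_power coef_nonneg intro!: mult_left_mono power_mono p)
    also have "\<dots> = norm (row (of_real R) k)"
    proof -
      have "row (of_real R) k = of_real (\<Sum>l\<le>k. coef k l * R ^ l)" by (simp add: row_def)
      moreover have "(\<Sum>l\<le>k. coef k l * R ^ l) \<ge> 0"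
        using R by (intro sum_nonneg mult_nonneg_nonneg coef_nonneg) auto
      ultimately show ?thesis by (simp del: of_real_sum)
    qed
    finally show "norm (row (snd p) k * fst p ^ k) \<le> M k"
      unfolding M_def norm_mult norm_power using R p by (intro mult_mono power_mono) auto
  qed
  then show ?thesis by (simp add: T_sum_def case_prod_unfold)
qed

text \<open>Stated on a disc because the kernel is also evaluated at conjugates, which may leave a
  given compact set but not the disc.\<close>

lemma \<Phi>_part_uniform:
  assumes e: "e > 0"
  shows "\<forall>\<^sub>F N in sequentially. \<forall>z w. norm z \<le> R \<longrightarrow> norm w \<le> R \<longrightarrow> norm (\<Phi>_part N z w - \<Phi> z w) < e"
proof -
  define d where "d = e / (2 * (\<bar>R\<bar> + 1))"
  have d: "d > 0" using e by (simp add: d_def add_nonneg_pos)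
  define R' where "R' = \<sigma>\<^sup>2 * R\<^sup>2"
  have "\<forall>\<^sub>F N in sequentially. \<forall>p \<in> cball 0 R' \<times> cball 0 R'.
      dist (case p of (x, y) \<Rightarrow> \<Sum>k<N. row y k * x ^ k) (case p of (x, y) \<Rightarrow> T_sum x y) < d"
    using T_partial_sums_uniform[of R'] d unfolding uniform_limit_iff by blast
  then show ?thesis
  proof (rule eventually_mono, intro allI impI)
    fix N :: nat and z w :: complex
    assume *: "\<forall>p \<in> cball 0 R' \<times> cball 0 R'.
      dist (case p of (x, y) \<Rightarrow> \<Sum>k<N. row y k * x ^ k) (case p of (x, y) \<Rightarrow> T_sum x y) < d"
    assume z: "norm z \<le> R" and w: "norm w \<le> R"
    define x y where "x = (of_real \<sigma>)\<^sup>2 * z\<^sup>2" and "y = (of_real \<sigma>)\<^sup>2 * w\<^sup>2"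
    have xy: "x \<in> cball 0 R'" "y \<in> cball 0 R'"
      using z w by (auto simp: x_def y_def R'_def norm_mult norm_power intro!: mult_left_mono power_mono)
    define a where "a = (\<Sum>k<N. row y k * x ^ k) - T_sum x y"
    define b where "b = (\<Sum>k<N. row x k * y ^ k) - T_sum y x"
    have ab: "norm a < d" "norm b < d"
      using bspec[OF *, of "(x, y)"] bspec[OF *, of "(y, x)"] xy by (auto simp: a_def b_def dist_norm)
    have "norm (\<Phi>_part N z w - \<Phi> z w) = norm (z * a - w * b)"
      unfolding \<Phi>_part_def \<Phi>_def x_def[symmetric] y_def[symmetric] a_def b_def by (simp add: algebra_simps)
    also have "\<dots> \<le> norm z * norm a + norm w * norm b"
      by (metis norm_mult norm_triangle_ineq4)
    also have "\<dots> \<le> \<bar>R\<bar> * d + \<bar>R\<bar> * d"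
      using z w ab by (intro add_mono mult_mono) auto
    also have "\<dots> < 2 * (\<bar>R\<bar> + 1) * d" using d by (simp add: algebra_simps)
    also have "\<dots> = e" by (simp add: d_def field_simps add_nonneg_pos)
    finally show "norm (\<Phi>_part N z w - \<Phi> z w) < e" .
  qed
qed

text \<open>The powers of N from the polynomial and the skew-norm combine to an exponent symmetric
  in \<open>k\<close> and \<open>l\<close>, as -(k - l) + (2 k + c + 2) = k + l + c + 2. This allows
  the cancellation against powers of \<open>r_scale\<close>.\<close>

lemma q_even_div_skew_norm:
  "q_even lam c N k \<zeta> / of_real (skew_norm lam c N k) =
     (\<Sum>l\<le>k. of_real (lam / 2 * coef k l * real N powr ((real k + real l + c + 2) / lam)) * \<zeta> ^ (2 * l))"
  if "N \<ge> 1"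
proof -
  define Pr where "Pr l = (\<Prod>j=l..<k. Gamma ((2 * real j + 3 + c) / lam) / Gamma ((2 * real j + 2 + c) / lam))" for l
  have N: "real N > 0" using that by simp
  have Pr: "(\<Prod>j<k - l. Gamma ((2 * real l + 2 * real j + 3 + c) / lam) / Gamma ((2 * real l + 2 * real j + 2 + c) / lam)) = Pr l"
    if "l \<le> k" for l
    unfolding Pr_def using that
    by (intro prod.reindex_bij_witness[of _ "\<lambda>j. j - l" "\<lambda>j. j + l"]) (auto simp: algebra_simps)
  define t where "t l = \<zeta> ^ (2 * l) * of_real (real N powr (- (real (k - l) / lam)) * Pr l)" for l
  have "q_even lam c N k \<zeta> = t k + (\<Sum>l<k. t l)"
    unfolding q_even_def
  proof (intro arg_cong2[of _ _ _ _ "(+)"] sum.cong refl)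
    show "\<zeta> ^ (2 * k) = t k" using N by (simp add: t_def Pr_def)
    fix l assume "l \<in> {..<k}"
    then have Pr: "(\<Prod>j<k - l. Gamma ((2 * real l + 2 * real j + 3 + c) / lam) / Gamma ((2 * real l + 2 * real j + 2 + c) / lam)) = Pr l"
      using Pr by simp
    show "\<zeta> ^ (2 * l) / of_real (real N powr (real (k - l) / lam)) *
        of_real (\<Prod>j<k - l. Gamma ((2 * real l + 2 * real j + 3 + c) / lam) / Gamma ((2 * real l + 2 * real j + 2 + c) / lam)) = t l"
      unfolding Pr t_def powr_minus_divide of_real_mult of_real_divide of_real_1 by simp
  qed
  also have "\<dots> = (\<Sum>l\<le>k. t l)"
    by (simp add: lessThan_Suc_atMost[symmetric])
  finally have "q_even lam c N k \<zeta> / of_real (skew_norm lam c N k) = (\<Sum>l\<le>k. t l / of_real (skew_norm lam c N k))"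
    by (simp add: sum_divide_distrib)
  also have "\<dots> = (\<Sum>l\<le>k. of_real (lam / 2 * coef k l * real N powr ((real k + real l + c + 2) / lam)) * \<zeta> ^ (2 * l))"
  proof (rule sum.cong[OF refl])
    fix l assume "l \<in> {..k}"
    then have l: "l \<le> k" by simp
    define g where "g = Gamma ((2 * real k + 2 + c) / lam)"
    have g: "g > 0" unfolding g_def by (rule Gamma_pos) simp
    have "(real k + real l + c + 2) / lam = - (real (k - l) / lam) + (2 * real k + c + 2) / lam"
      using l lam_pos by (simp add: field_simps of_nat_diff)
    then have "real N powr ((real k + real l + c + 2) / lam) =
        real N powr (- (real (k - l) / lam)) * real N powr ((2 * real k + c + 2) / lam)"
      by (simp only: powr_add)
    moreover have "coef k l = Pr l / g" using l by (simp add: coef_def Pr_def g_def)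
    moreover have "skew_norm lam c N k = 2 / lam * g / real N powr ((2 * real k + c + 2) / lam)"
      by (simp add: skew_norm_def g_def add_ac)
    ultimately have "real N powr (- (real (k - l) / lam)) * Pr l / skew_norm lam c N k =
        lam / 2 * coef k l * real N powr ((real k + real l + c + 2) / lam)"
      using g lam_pos N by (simp only:) (simp add: divide_simps)
    from arg_cong[OF this, of "complex_of_real"]
    show "t l / of_real (skew_norm lam c N k) =
       of_real (lam / 2 * coef k l * real N powr ((real k + real l + c + 2) / lam)) * \<zeta> ^ (2 * l)"
      unfolding t_def of_real_divide by (metis (no_types, lifting) mult.commute times_divide_eq_right)
  qed
  finally show ?thesis .
qed

lemma r_scale_pos: "N \<ge> 1 \<Longrightarrow> r_scale lam N > 0"
  using lam_pos by (simp add: r_scale_def)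

lemma N_powr:
  assumes "N \<ge> 1"
  shows "real N powr (x / lam) = (\<sigma> / r_scale lam N) powr (2 * x)"
proof -
  have N: "real N > 0" using assms by simp
  have "\<sigma> / r_scale lam N = real N powr (1 / (2 * lam))"
    using N lam_pos by (simp add: \<sigma>_def r_scale_def powr_divide powr_mult powr_minus field_simps)
  then show ?thesis using lam_pos by (simp add: powr_powr)
qed

text \<open>The factor with exponent 2 c is taken from the weight, each of whose two halves carries
  r^c.\<close>

lemma prekernel_rescaled_eq:
  assumes N: "N \<ge> 1"
  shows "of_real (r_scale lam N powr (2 * c)) * prekernel_rescaled lam c N z w = of_real amplitude * \<Phi>_part N z w"
proof -
  define r where "r = r_scale lam N"
  have r: "r > 0" using r_scale_pos[OF N] by (simp add: r_def)
  have main: "of_real (r powr (2 * c)) * of_real (r ^ 3) *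
      (q_odd k (of_real r * z) * (q_even lam c N k (of_real r * w) / of_real (skew_norm lam c N k))) =
      of_real amplitude * (z * (row ((of_real \<sigma>)\<^sup>2 * w\<^sup>2) k * ((of_real \<sigma>)\<^sup>2 * z\<^sup>2) ^ k))" for k z w
  proof -
    \<comment> \<open>The exponents of \<open>r\<close> add up to 2 c + 3 + (2 k + 1) + 2 l = 2 (k +
      l + c + 2), which is the exponent of \<sigma> / r in the power of N.\<close>
    have *: "r powr (2 * c) * r ^ 3 * r ^ (2 * k + 1) * r ^ (2 * l) * (lam / 2 * coef k l * real N powr ((real k + real l + c + 2) / lam))
       = amplitude * coef k l * \<sigma> ^ (2 * l) * \<sigma> ^ (2 * k)" for l
    proof -
      have "2 * (real k + real l + c + 2) = 2 * c + real (2 * k + 2 * l + 4)" by simp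
      moreover have "(\<sigma> / r) powr real (2 * k + 2 * l + 4) = (\<sigma> / r) ^ (2 * k + 2 * l + 4)"
        using r \<sigma>_pos by (intro powr_realpow) simp
      ultimately have "real N powr ((real k + real l + c + 2) / lam) = (\<sigma> / r) powr (2 * c) * (\<sigma> / r) ^ (2 * k + 2 * l + 4)"
        unfolding N_powr[OF N] r_def[symmetric] by (simp only: powr_add)
      also have "(\<sigma> / r) powr (2 * c) = \<sigma> powr (2 * c) / r powr (2 * c)"
        using r \<sigma>_pos by (simp add: powr_divide)
      finally show ?thesis
        using r by (simp add: amplitude_def power_divide power_add power_mult field_simps eval_nat_numeral)
    qed
    have "of_real (r powr (2 * c)) * of_real (r ^ 3) *
      (q_odd k (of_real r * z) * (q_even lam c N k (of_real r * w) / of_real (skew_norm lam c N k))) =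
      (\<Sum>l\<le>k. of_real (r powr (2 * c) * r ^ 3 * r ^ (2 * k + 1) * r ^ (2 * l) *
          (lam / 2 * coef k l * real N powr ((real k + real l + c + 2) / lam))) * (z ^ (2 * k + 1) * w ^ (2 * l)))"
      unfolding q_even_div_skew_norm[OF N] q_odd_def sum_distrib_left
      by (intro sum.cong refl) (simp only: of_real_mult of_real_power power_mult_distrib mult_ac)
    also have "\<dots> = of_real amplitude * (z * (row ((of_real \<sigma>)\<^sup>2 * w\<^sup>2) k * ((of_real \<sigma>)\<^sup>2 * z\<^sup>2) ^ k))"
      unfolding * row_def sum_distrib_left sum_distrib_right
      by (intro sum.cong refl) (simp add: power_mult_distrib power_mult power2_eq_square mult_ac)
    finally show ?thesis .
  qed
  have "of_real (r powr (2 * c)) * prekernel_rescaled lam c N z w =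
     (\<Sum>k<N. of_real (r powr (2 * c)) * of_real (r ^ 3) *
        (q_odd k (of_real r * z) * (q_even lam c N k (of_real r * w) / of_real (skew_norm lam c N k))) -
       of_real (r powr (2 * c)) * of_real (r ^ 3) *
        (q_odd k (of_real r * w) * (q_even lam c N k (of_real r * z) / of_real (skew_norm lam c N k))))"
    unfolding prekernel_rescaled_def r_def[symmetric] prekernel_def sum_distrib_left
    by (intro sum.cong refl) (simp add: diff_divide_distrib algebra_simps)
  then show ?thesis
    unfolding main r_def[symmetric] \<Phi>_part_def
    by (simp add: sum_subtractf sum_distrib_left right_diff_distrib)
qed

text \<open>The case distinction is needed because \<open>0 powr 0 = 0\<close> in HOL.\<close>
definition modulus_factor :: "complex \<Rightarrow> real" where
  "modulus_factor z = (if c = 0 then 1 else cmod z powr c)"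

text \<open>On the cut, where \<open>cnj z = z\<close>, the reflection law of a cocycle only allows the values 1 and -1.\<close>
definition phase :: "complex \<Rightarrow> complex" where
  "phase z = (if z \<in> \<real>\<^sub>\<le>\<^sub>0 then 1 else exp (\<i> * of_real (c * Arg z)))"

text \<open>Off the cut, phase times modulus is the principal power z^c. Keeping the two apart
  defines the limit on the cut as well.\<close>

definition \<kappa>_lim :: "complex \<Rightarrow> complex \<Rightarrow> complex" where
  "\<kappa>_lim z w = phase z * phase w * of_real (modulus_factor z * modulus_factor w * amplitude) * \<Phi> z w"

text \<open>The scale satisfies r^(2 lam) = 2 / (lam N), so that N/2 times |r z|^(2 lam) is |z|^(2
  lam) / lam. At z = 0 both sides are 0 if c \<noteq> 0 and 1 if c = 0.\<close>

lemma half_weight_rescaled: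
  assumes N: "N \<ge> 1"
  shows "half_weight lam c N (of_real (r_scale lam N) * z) =
    r_scale lam N powr c * modulus_factor z * exp (- (cmod z powr (2 * lam) / lam))"
proof -
  define r where "r = r_scale lam N"
  have r: "r > 0" using r_scale_pos[OF N] by (simp add: r_def)
  have Nr: "real N > 0" using N by simp
  show ?thesis
  proof (cases "z = 0")
    case True
    then show ?thesis using r
      by (auto simp: half_weight_def Q_pot_def modulus_factor_def r_def[symmetric])
  next
    case False
    have r2: "r powr (2 * lam) = 2 / (lam * real N)"
    proof -
      have "- 1 / (2 * lam) * (2 * lam) = - 1" using lam_pos by simp
      then show ?thesis
        unfolding r_def r_scale_def powr_powr using lam_pos Nr by (simp only:) (simp add: powr_minus_divide)
    qed
    have "cmod (of_real r * z) powr (2 * lam) = 2 / (lam * real N) * cmod z powr (2 * lam)"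
      using r by (simp only: norm_mult norm_of_real abs_of_pos powr_mult r2 norm_ge_zero less_imp_le)
    moreover have "ln (cmod (of_real r * z)) = ln r + ln (cmod z)"
      using r False by (simp add: norm_mult ln_mult)
    ultimately have "- (real N / 2) * Q_pot lam c N (of_real r * z) =
        - (cmod z powr (2 * lam) / lam) + c * (ln r + ln (cmod z))"
      unfolding Q_pot_def using Nr lam_pos by (simp only:) (simp add: field_simps)
    then have "half_weight lam c N (of_real r * z) =
       exp (- (cmod z powr (2 * lam) / lam)) * exp (c * ln r) * exp (c * ln (cmod z))"
      using False r by (simp add: half_weight_def exp_add[symmetric] algebra_simps)
    then show ?thesis
      using False r by (simp add: r_def[symmetric] modulus_factor_def powr_def)
  qed
qed

text \<open>The four matrix entries share the weight at (z, w) but evaluate the pre-kernel at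
  conjugates, hence the separate \<open>x\<close> and \<open>y\<close>. On the right, N occurs only
  as the length of the partial sums.\<close>

lemma weight_times_prekernel:
  assumes N: "N \<ge> 1"
  shows "of_real (weight_rescaled lam c N z w) * prekernel_rescaled lam c N x y =
    of_real (weight_limit lam z w * (modulus_factor z * modulus_factor w * amplitude)) * \<Phi>_part N x y"
proof -
  define r where "r = r_scale lam N"
  have r2: "r powr c * r powr c = r powr (2 * c)" by (simp flip: powr_add)
  have wl: "weight_limit lam z w = exp (- (cmod z powr (2 * lam) / lam)) * exp (- (cmod w powr (2 * lam) / lam))"
    unfolding weight_limit_def by (simp add: exp_add[symmetric] add_divide_distrib diff_divide_distrib)
  have "weight_rescaled lam c N z w = weight_limit lam z w * (modulus_factor z * modulus_factor w) * r powr (2 * c)"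
    unfolding weight_rescaled_def half_weight_rescaled[OF N]
    unfolding r_def[symmetric] wl r2[symmetric] by (simp only: mult_ac)
  then show ?thesis
    using prekernel_rescaled_eq[OF N, of x y] unfolding r_def[symmetric] by (simp add: mult_ac)
qed

lemma norm_phase: "norm (phase z) = 1"
  by (simp add: phase_def)

lemma phase_cnj: "phase (cnj z) = 1 / phase z"
proof -
  have "cnj z \<in> \<real>\<^sub>\<le>\<^sub>0 \<longleftrightarrow> z \<in> \<real>\<^sub>\<le>\<^sub>0" by (auto simp: complex_nonpos_Reals_iff)
  moreover have "Arg (cnj z) = - Arg z" if "z \<notin> \<real>\<^sub>\<le>\<^sub>0"
  proof (cases "z \<in> \<real>")
    case True
    then have "Arg z = 0" using that by (auto simp: Arg_eq_0 complex_nonpos_Reals_iff complex_is_Real_iff)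
    then show ?thesis using True by (simp add: Arg_cnj)
  qed (simp add: Arg_cnj)
  ultimately show ?thesis
    by (simp add: phase_def exp_minus inverse_eq_divide)
qed

lemma continuous_on_phase: "continuous_on (- \<real>\<^sub>\<le>\<^sub>0) phase"
proof -
  have "continuous_on (- \<real>\<^sub>\<le>\<^sub>0) (\<lambda>z. exp (\<i> * of_real (c * Arg z)))"
    by (intro continuous_intros continuous_on_Arg)
  then show ?thesis
    by (rule continuous_on_eq) (auto simp: phase_def)
qed

lemma cocycle_phase: "cocycle (\<lambda>z w. phase z * phase w)"
  unfolding cocycle_def
  using continuous_on_phase norm_phase phase_cnj by (intro exI[of _ phase]) auto

lemma phase_modulus_factor:
  assumes "z \<notin> \<real>\<^sub>\<le>\<^sub>0"
  shows "phase z * of_real (modulus_factor z) = z powr of_real c"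
proof -
  have "z \<noteq> 0" using assms by auto
  then have "Ln z = of_real (ln (cmod z)) + \<i> * of_real (Arg z)"
    by (simp add: complex_eq_iff Arg_eq_Im_Ln)
  then show ?thesis
    using assms \<open>z \<noteq> 0\<close>
    by (simp add: phase_def modulus_factor_def powr_def distrib_left exp_add mult_ac flip: exp_of_real)
qed

section \<open>Holomorphy of the limit and the change of variables z -> sqrt(2/lam) z^lam\<close>

lemma holomorphic_T_sum:
  "(\<lambda>x. T_sum x y) holomorphic_on UNIV" "(\<lambda>y. T_sum x y) holomorphic_on UNIV"
proof -
  have ps: "(\<lambda>x. \<Sum>k. a k * x ^ k) holomorphic_on UNIV" if "entire_coeffs a" for a
    using termdiffs_strong_converges_everywhere[OF entire_coeffs_summable[OF that]]
    by (meson holomorphic_on_open open_UNIV)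
  show "(\<lambda>x. T_sum x y) holomorphic_on UNIV"
    unfolding T_sum_def by (rule ps[OF entire_coeffs_row])
  show "(\<lambda>y. T_sum x y) holomorphic_on UNIV"
    unfolding T_sum_def row_col_swap by (rule ps[OF entire_coeffs_col])
qed

lemma holomorphic_\<Phi>: "(\<lambda>z. \<Phi> z w) holomorphic_on A"
proof -
  have sq: "(\<lambda>z. (of_real \<sigma>)\<^sup>2 * z\<^sup>2) holomorphic_on A" by (intro holomorphic_intros)
  have "(\<lambda>z. T_sum ((of_real \<sigma>)\<^sup>2 * z\<^sup>2) y) holomorphic_on A" for y
    using holomorphic_on_compose_gen[OF sq holomorphic_T_sum(1)[of y]] by (simp add: o_def)
  moreover have "(\<lambda>z. T_sum x ((of_real \<sigma>)\<^sup>2 * z\<^sup>2)) holomorphic_on A" for x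
    using holomorphic_on_compose_gen[OF sq holomorphic_T_sum(2)[of x]] by (simp add: o_def)
  ultimately show ?thesis
    unfolding \<Phi>_def by (intro holomorphic_intros)
qed

lemma \<Phi>_antisym: "\<Phi> w z = - \<Phi> z w"
  by (simp add: \<Phi>_def)

lemma \<kappa>_lim_slit:
  assumes "z \<notin> \<real>\<^sub>\<le>\<^sub>0" "w \<notin> \<real>\<^sub>\<le>\<^sub>0"
  shows "\<kappa>_lim z w = of_real amplitude * (z powr of_real c * w powr of_real c) * \<Phi> z w"
  unfolding \<kappa>_lim_def phase_modulus_factor[OF assms(1), symmetric] phase_modulus_factor[OF assms(2), symmetric]
  by simp

lemma \<kappa>_lim_holomorphic: "holomorphic_in_both \<kappa>_lim (- \<real>\<^sub>\<le>\<^sub>0)"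
proof -
  have left: "(\<lambda>z. \<kappa>_lim z w) holomorphic_on - \<real>\<^sub>\<le>\<^sub>0" if "w \<in> - \<real>\<^sub>\<le>\<^sub>0" for w
  proof -
    have "(\<lambda>z. of_real amplitude * (z powr of_real c * w powr of_real c) * \<Phi> z w) holomorphic_on - \<real>\<^sub>\<le>\<^sub>0"
      by (intro holomorphic_intros holomorphic_\<Phi>) auto
    then show ?thesis
      by (rule holomorphic_transform) (use that in \<open>auto simp: \<kappa>_lim_slit\<close>)
  qed
  have flip: "(\<lambda>w. \<kappa>_lim z w) = (\<lambda>w. - \<kappa>_lim w z)" for z
  proof
    show "\<kappa>_lim z w = - \<kappa>_lim w z" for w
      unfolding \<kappa>_lim_def \<Phi>_antisym[of w z] by (simp add: mult.commute mult.left_commute)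
  qed
  have "(\<lambda>w. \<kappa>_lim z w) holomorphic_on - \<real>\<^sub>\<le>\<^sub>0" if "z \<in> - \<real>\<^sub>\<le>\<^sub>0" for z
    by (subst flip) (rule holomorphic_on_minus[OF left[OF that]])
  then show ?thesis using left unfolding holomorphic_in_both_def by blast
qed

text \<open>In the sector the nested principal powers combine, and exponents can be compared factor
  by factor. The powers of sqrt(2/lam) are converted into powers of \<sigma>.\<close>

lemma \<kappa>_lim_limit_prekernel: "limit_prekernel lam \<kappa>_fun \<kappa>_lim"
  unfolding limit_prekernel_def
proof (intro conjI ballI impI \<kappa>_lim_holomorphic)
  fix z w :: complex
  assume "z \<in> - \<real>\<^sub>\<le>\<^sub>0" "w \<in> - \<real>\<^sub>\<le>\<^sub>0" and "lam * \<bar>Arg z\<bar> < pi \<and> lam * \<bar>Arg w\<bar> < pi"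
  then have zw: "z \<notin> \<real>\<^sub>\<le>\<^sub>0" "w \<notin> \<real>\<^sub>\<le>\<^sub>0" and arg: "lam * \<bar>Arg z\<bar> < pi" "lam * \<bar>Arg w\<bar> < pi" by auto
  then have nz: "z \<noteq> 0" "w \<noteq> 0" by auto
  define s where "s = sqrt (2 / lam)"
  have s: "s > 0" using lam_pos by (simp add: s_def)
  define Z where "Z z = of_real s * z powr of_real lam" for z :: complex
  have Z_powr: "Z z powr of_real e = of_real (s powr e) * z powr of_real (lam * e)"
    if "z \<noteq> 0" "lam * \<bar>Arg z\<bar> < pi" for z e
    unfolding Z_def using s that lam_pos
    by (simp only: powr_of_real_mult_left less_imp_le) (subst powr_powr_complex, auto simp: abs_mult)
  have s_\<sigma>: "s powr (e / lam) = \<sigma> powr e" for e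
    unfolding s_def \<sigma>_def using lam_pos by (simp add: powr_half_sqrt[symmetric] powr_powr)
  have sq: "Z z powr of_real (2 / lam) = (of_real \<sigma>)\<^sup>2 * z\<^sup>2" if "z \<noteq> 0" "lam * \<bar>Arg z\<bar> < pi" for z
  proof -
    have "lam * (2 / lam) = 2" using lam_pos by simp
    moreover have "s powr (2 / lam) = \<sigma>\<^sup>2" using s_\<sigma>[of 2] \<sigma>_pos by simp
    ultimately show ?thesis using Z_powr[OF that, of "2 / lam"] by simp
  qed
  have G: "of_real \<sigma> * (z powr of_real (lam - 1) * w powr of_real (lam - 1)) * G_fun (Z z) (Z w) =
     of_real amplitude * (z powr of_real c * w powr of_real c) * (z * T_sum ((of_real \<sigma>)\<^sup>2 * z\<^sup>2) ((of_real \<sigma>)\<^sup>2 * w\<^sup>2))"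
    if nz: "z \<noteq> 0" "w \<noteq> 0" and arg: "lam * \<bar>Arg z\<bar> < pi" "lam * \<bar>Arg w\<bar> < pi" for z w
  proof -
    have e1: "lam * ((2 + c) / lam - 1) = 2 + c - lam" "lam * ((1 + c) / lam - 1) = 1 + c - lam"
      using lam_pos by (simp_all add: field_simps)
    have G: "G_fun (Z z) (Z w) = of_real (s powr ((2 + c) / lam - 1)) * z powr of_real (2 + c - lam) *
       (of_real (s powr ((1 + c) / lam - 1)) * w powr of_real (1 + c - lam)) *
       T_sum ((of_real \<sigma>)\<^sup>2 * z\<^sup>2) ((of_real \<sigma>)\<^sup>2 * w\<^sup>2)"
      unfolding G_fun_def Z_powr[OF nz(1) arg(1)] Z_powr[OF nz(2) arg(2)] e1
      unfolding sq[OF nz(1) arg(1), unfolded Z_powr[OF nz(1) arg(1)]] sq[OF nz(2) arg(2), unfolded Z_powr[OF nz(2) arg(2)]] ..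
    have zz: "z powr of_real (lam - 1) * z powr of_real (2 + c - lam) = z powr of_real c * z"
    proof -
      have "of_real (lam - 1) + of_real (2 + c - lam) = of_real c + (1::complex)" by simp
      then show ?thesis using nz by (simp only: powr_add[symmetric]) (simp add: powr_add)
    qed
    have ww: "w powr of_real (lam - 1) * w powr of_real (1 + c - lam) = w powr of_real c"
    proof -
      have "of_real (lam - 1) + of_real (1 + c - lam) = (of_real c :: complex)" by simp
      then show ?thesis by (simp only: powr_add[symmetric])
    qed
    \<comment> \<open>The two exponents of \<open>s\<close> add up to (3 + 2 c)/lam - 2. The first
      part gives \<sigma>^(3 + 2 c), and s^(-2) = lam/2.\<close>
    have "\<sigma> * (s powr ((2 + c) / lam - 1) * s powr ((1 + c) / lam - 1)) = amplitude"
    proof -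
      have e: "(2 + c) / lam - 1 + ((1 + c) / lam - 1) = (3 + 2 * c) / lam - 2"
        using lam_pos by (simp add: field_simps)
      have "s powr 2 = 2 / lam" using s lam_pos by (simp add: s_def)
      moreover have "s powr ((3 + 2 * c) / lam) = \<sigma> ^ 3 * \<sigma> powr (2 * c)"
        unfolding s_\<sigma> powr_add using \<sigma>_pos by simp
      ultimately have "s powr ((2 + c) / lam - 1) * s powr ((1 + c) / lam - 1) = \<sigma> ^ 3 * \<sigma> powr (2 * c) * (lam / 2)"
        unfolding powr_add[symmetric] e by (simp only: powr_diff) simp
      moreover have "\<sigma> * (\<sigma> ^ 3 * \<sigma> powr (2 * c) * (lam / 2)) = amplitude"
        by (simp add: amplitude_def eval_nat_numeral)
      ultimately show ?thesis by (simp only:)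
    qed
    then have amp: "of_real \<sigma> * (of_real (s powr ((2 + c) / lam - 1)) * of_real (s powr ((1 + c) / lam - 1))) = (of_real amplitude :: complex)"
      by (simp only: of_real_mult[symmetric])
    show ?thesis
    proof -
      have rearr: "of_real \<sigma> * (Pz * Pw) * (s1 * Qz * (s2 * Qw) * T) = of_real \<sigma> * (s1 * s2) * ((Pz * Qz) * (Pw * Qw)) * T"
        for Pz Pw s1 s2 Qz Qw T :: complex by simp
      show ?thesis unfolding G rearr amp zz ww by (simp only: mult_ac)
    qed
  qed
  have \<sigma>': "(2 / lam) powr (1 / (2 * lam)) = \<sigma>" by (simp add: \<sigma>_def)
  have "of_real \<sigma> * pow_mult z w (lam - 1) * \<kappa>_fun (Z z) (Z w) =
     of_real \<sigma> * (z powr of_real (lam - 1) * w powr of_real (lam - 1)) * G_fun (Z z) (Z w) -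
     of_real \<sigma> * (w powr of_real (lam - 1) * z powr of_real (lam - 1)) * G_fun (Z w) (Z z)"
    unfolding pow_mult_def \<kappa>_fun_def by (simp only: right_diff_distrib mult_ac)
  also have "\<dots> = \<kappa>_lim z w"
    unfolding G[OF nz arg] G[OF nz(2,1) arg(2,1)] \<kappa>_lim_slit[OF zw] \<Phi>_def
    by (simp only: right_diff_distrib mult_ac)
  finally show "\<kappa>_lim z w = of_real ((2 / lam) powr (1 / (2 * lam))) * pow_mult z w (lam - 1) *
      \<kappa>_fun (of_real (sqrt (2 / lam)) * z powr of_real lam) (of_real (sqrt (2 / lam)) * w powr of_real lam)"
    unfolding \<sigma>' Z_def s_def by simp
qed

text \<open>
  The weight \<open>g\<close> is 1 for the plain limit and cancels the singular moduli at the origin when \<open>c < 0\<close>.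
\<close>
lemma weighted_kernel_uniform_limit:
  assumes S: "\<And>z. z \<in> S \<Longrightarrow> norm z \<le> R"
    and B: "\<And>z w. z \<in> S \<Longrightarrow> w \<in> S \<Longrightarrow> \<bar>g z w * (modulus_factor z * modulus_factor w)\<bar> \<le> B"
  shows "uniform_limit (S \<times> S)
     (\<lambda>N (z, w). g z w *\<^sub>R cocycle_kernel (\<lambda>z w. phase z * phase w) lam c N z w)
     (\<lambda>(z, w). g z w *\<^sub>R kernel_matrix (weight_limit lam) \<kappa>_lim z w) sequentially"
  unfolding uniform_limit_iff
proof (intro allI impI)
  fix e :: real assume e: "e > 0"
  \<comment> \<open>The 4 distributes \<open>e\<close> over the matrix entries; the summand 1 keeps
    \<open>B'\<close> positive and the final estimate strict.\<close>
  define B' where "B' = 4 * (\<bar>B\<bar> * \<bar>amplitude\<bar> + 1)"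
  have B': "B' > 0" by (simp add: B'_def add_nonneg_pos)
  have "\<forall>\<^sub>F N in sequentially. \<forall>z w. norm z \<le> R \<longrightarrow> norm w \<le> R \<longrightarrow> norm (\<Phi>_part N z w - \<Phi> z w) < e / B'"
    using e B' by (intro \<Phi>_part_uniform) simp
  moreover have "\<forall>\<^sub>F N in sequentially. N \<ge> 1" by (rule eventually_ge_at_top)
  ultimately show "\<forall>\<^sub>F N in sequentially. \<forall>p\<in>S \<times> S.
     dist (case p of (z, w) \<Rightarrow> g z w *\<^sub>R cocycle_kernel (\<lambda>z w. phase z * phase w) lam c N z w)
      (case p of (z, w) \<Rightarrow> g z w *\<^sub>R kernel_matrix (weight_limit lam) \<kappa>_lim z w) < e"
  proof eventually_elim
    case (elim N)
    show ?case
    proof clarify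
      fix z w assume zw: "z \<in> S" "w \<in> S"
      define A where "A = g z w *\<^sub>R cocycle_kernel (\<lambda>z w. phase z * phase w) lam c N z w -
         g z w *\<^sub>R kernel_matrix (weight_limit lam) \<kappa>_lim z w"
      \<comment> \<open>The weight stays at (z, w) while \<open>x\<close> and \<open>y\<close> may
        be conjugated, so one estimate covers all four entries.\<close>
      define entry where "entry x y = of_real (g z w) * (of_real (weight_rescaled lam c N z w) *
         (phase x * phase y * prekernel_rescaled lam c N x y) - of_real (weight_limit lam z w) * \<kappa>_lim x y)" for x y
      have entry: "norm (entry x y) < e / 4" if "x = z \<or> x = cnj z" "y = w \<or> y = cnj w" for x y
      proof -
        have m: "modulus_factor x = modulus_factor z" "modulus_factor y = modulus_factor w"
          using that by (auto simp: modulus_factor_def)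
        have "norm x \<le> R" "norm y \<le> R" using that S zw by auto
        then have lt: "norm (\<Phi>_part N x y - \<Phi> x y) < e / B'" using elim(1) by blast
        have 1: "of_real (weight_rescaled lam c N z w) * (phase x * phase y * prekernel_rescaled lam c N x y) =
          phase x * phase y * (of_real (weight_limit lam z w * (modulus_factor z * modulus_factor w * amplitude)) * \<Phi>_part N x y)"
          unfolding weight_times_prekernel[OF elim(2), of z w x y, symmetric] by (simp only: mult_ac)
        have "entry x y = phase x * phase y * of_real (weight_limit lam z w) *
            of_real (g z w * (modulus_factor z * modulus_factor w)) * of_real amplitude * (\<Phi>_part N x y - \<Phi> x y)"
          unfolding entry_def 1 \<kappa>_lim_def m by (simp add: algebra_simps)
        then have "norm (entry x y) = weight_limit lam z w *
            (\<bar>g z w * (modulus_factor z * modulus_factor w)\<bar> * \<bar>amplitude\<bar> * norm (\<Phi>_part N x y - \<Phi> x y))"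
          by (simp only: norm_mult norm_phase norm_of_real) (simp add: weight_limit_def)
        also have "\<dots> \<le> 1 * (\<bar>B\<bar> * \<bar>amplitude\<bar> * norm (\<Phi>_part N x y - \<Phi> x y))"
        proof (rule mult_mono)
          have "- (cmod z powr (2 * lam) + cmod w powr (2 * lam)) / lam \<le> 0"
            using lam_pos by (intro divide_nonpos_pos) (simp_all add: add_nonneg_nonneg del: minus_add_distrib)
          then show "weight_limit lam z w \<le> 1" unfolding weight_limit_def by simp
          show "\<bar>g z w * (modulus_factor z * modulus_factor w)\<bar> * \<bar>amplitude\<bar> * norm (\<Phi>_part N x y - \<Phi> x y)
              \<le> \<bar>B\<bar> * \<bar>amplitude\<bar> * norm (\<Phi>_part N x y - \<Phi> x y)"
            using B[OF zw] by (intro mult_right_mono) auto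
        qed auto
        also have "\<dots> \<le> (\<bar>B\<bar> * \<bar>amplitude\<bar> + 1) * norm (\<Phi>_part N x y - \<Phi> x y)"
          by (simp add: algebra_simps)
        also have "\<dots> < (\<bar>B\<bar> * \<bar>amplitude\<bar> + 1) * (e / B')"
          using lt by (intro mult_strict_left_mono) (auto simp: add_nonneg_pos)
        also have "\<dots> = e / 4" using B' by (simp add: B'_def field_simps)
        finally show ?thesis .
      qed
      have "A $ 1 $ 1 = entry z w" "A $ 1 $ 2 = entry z (cnj w)" "A $ 2 $ 1 = entry (cnj z) w" "A $ 2 $ 2 = entry (cnj z) (cnj w)"
        unfolding A_def cocycle_kernel_def kernel_matrix_def entry_def
        by (simp_all only: vector_minus_component vector_scaleR_component vector_2)
           (simp_all add: scaleR_conv_of_real right_diff_distrib)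
      then have "norm A < e"
        using norm_matrix_2_le[of A] entry[of z w] entry[of z "cnj w"] entry[of "cnj z" w] entry[of "cnj z" "cnj w"]
        by simp
      then show "dist (g z w *\<^sub>R cocycle_kernel (\<lambda>z w. phase z * phase w) lam c N z w)
         (g z w *\<^sub>R kernel_matrix (weight_limit lam) \<kappa>_lim z w) < e"
        by (simp add: A_def dist_norm)
    qed
  qed
qed

text \<open>It remains to bound |z|^c on \<open>S\<close>: for c \<ge> 0 by the size of
  \<open>S\<close>, for c < 0 by its distance from the origin.\<close>

lemma kernel_uniform_limit:
  assumes S: "compact S" "0 \<in> S \<longrightarrow> c \<ge> 0"
  shows "uniform_limit (S \<times> S) (\<lambda>N (z, w). cocycle_kernel (\<lambda>z w. phase z * phase w) lam c N z w)
     (\<lambda>(z, w). kernel_matrix (weight_limit lam) \<kappa>_lim z w) sequentially"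
proof -
  obtain R where R: "R > 0" "\<And>z. z \<in> S \<Longrightarrow> norm z \<le> R"
    using compact_imp_bounded[OF S(1)] by (auto simp: bounded_pos)
  obtain M where M: "\<And>z. z \<in> S \<Longrightarrow> modulus_factor z \<le> M"
  proof (cases "c \<ge> 0")
    case True
    have "modulus_factor z \<le> max 1 (R powr c)" if "z \<in> S" for z
      using powr_mono2[OF True norm_ge_zero R(2)[OF that]] by (auto simp: modulus_factor_def)
    then show ?thesis using that by blast
  next
    case False
    then have "0 \<notin> S" using S(2) by auto
    then obtain d where d: "d > 0" "\<And>z. z \<in> S \<Longrightarrow> d \<le> dist 0 z"
      using separate_point_closed[OF compact_imp_closed[OF S(1)]] by blast
    have "modulus_factor z \<le> d powr c" if "z \<in> S" for z
      using powr_mono2'[of c d "norm z"] d(1) d(2)[OF that] False by (simp add: modulus_factor_def)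
    then show ?thesis using that by blast
  qed
  have nonneg: "modulus_factor z \<ge> 0" for z by (simp add: modulus_factor_def)
  have "\<bar>1 * (modulus_factor z * modulus_factor w)\<bar> \<le> M * M" if "z \<in> S" "w \<in> S" for z w
    using M[OF that(1)] M[OF that(2)] nonneg[of z] nonneg[of w] by (simp add: abs_mult mult_mono')
  from weighted_kernel_uniform_limit[OF R(2) this] show ?thesis by simp
qed

text \<open>The extra weight times the two modulus factors is exactly 1 off the origin, so the bound
  does not deteriorate near it.\<close>

lemma weighted_kernel_uniform_limit_neg:
  assumes S: "compact S" and c: "c < 0"
  shows "uniform_limit ((S - {0}) \<times> (S - {0}))
     (\<lambda>N (z, w). (cmod z * cmod w) powr (- c) *\<^sub>R cocycle_kernel (\<lambda>z w. phase z * phase w) lam c N z w)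
     (\<lambda>(z, w). (cmod z * cmod w) powr (- c) *\<^sub>R kernel_matrix (weight_limit lam) \<kappa>_lim z w) sequentially"
proof -
  obtain R where R: "\<And>z. z \<in> S - {0} \<Longrightarrow> norm z \<le> R"
    using compact_imp_bounded[OF S(1)] by (auto simp: bounded_pos)
  have "\<bar>(cmod z * cmod w) powr (- c) * (modulus_factor z * modulus_factor w)\<bar> \<le> 1"
    if "z \<in> S - {0}" "w \<in> S - {0}" for z w
    using that c by (simp add: modulus_factor_def powr_mult powr_minus field_simps)
  from weighted_kernel_uniform_limit[OF R this] show ?thesis .
qed

end

theorem proposition4p1:
  fixes lam c :: real
  assumes "lam > 0" and "c > -1"
  shows "\<exists>(C :: nat \<Rightarrow> complex \<Rightarrow> complex \<Rightarrow> complex) \<kappa> \<kappa>t G.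
    (\<forall>N\<ge>1. cocycle (C N)) \<and>
    (\<forall>S. compact S \<and> (0 \<in> S \<longrightarrow> c \<ge> 0) \<longrightarrow>
       uniform_limit (S \<times> S) (\<lambda>N (z, w). cocycle_kernel (C N) lam c N z w)
         (\<lambda>(z, w). kernel_matrix (weight_limit lam) \<kappa> z w) sequentially) \<and>
    (c < 0 \<longrightarrow> (\<forall>S. compact S \<longrightarrow>
       uniform_limit ((S - {0}) \<times> (S - {0}))
         (\<lambda>N (z, w). (cmod z * cmod w) powr (- c) *\<^sub>R cocycle_kernel (C N) lam c N z w)
         (\<lambda>(z, w). (cmod z * cmod w) powr (- c) *\<^sub>R kernel_matrix (weight_limit lam) \<kappa> z w)
         sequentially)) \<and>
    limit_prekernel lam \<kappa>t \<kappa> \<and>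
    holomorphic_in_both G (- \<real>\<^sub>\<le>\<^sub>0) \<and>
    (\<forall>z \<in> - \<real>\<^sub>\<le>\<^sub>0. \<forall>w \<in> - \<real>\<^sub>\<le>\<^sub>0.
       \<kappa>t z w = G z w - G w z \<and>
       (1 / lam \<in> \<nat> \<or> of_int \<lceil>1 / lam\<rceil> < (2 + c) / lam \<longrightarrow>
          has_caputo_derivative (\<lambda>x. G x w) (1 / lam) z (rhs_G lam c G z w)) \<and>
       (1 / lam \<in> \<nat> \<or> of_int \<lceil>1 / lam\<rceil> < (1 + c) / lam \<longrightarrow>
          has_caputo_derivative (\<lambda>x. \<kappa>t x w) (1 / lam) z (rhs_\<kappa> lam c \<kappa>t z w)) \<and>
       has_RL_derivative (\<lambda>x. G x w) (1 / lam) z (rhs_G lam c G z w) \<and>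
       has_RL_derivative (\<lambda>x. \<kappa>t x w) (1 / lam) z (rhs_\<kappa> lam c \<kappa>t z w))"
proof -
  interpret origin_scaling lam c by unfold_locales (use assms in auto)
  show ?thesis
  \<comment> \<open>One cocycle serves for all N, because the phase of (z w)^c does not involve
    N.\<close>
  proof (rule exI[of _ "\<lambda>_ z w. phase z * phase w"], rule exI[of _ \<kappa>_lim], rule exI[of _ \<kappa>_fun],
      rule exI[of _ G_fun], intro conjI allI impI ballI)
    fix z w :: complex assume "z \<in> - \<real>\<^sub>\<le>\<^sub>0" "w \<in> - \<real>\<^sub>\<le>\<^sub>0"
    then have zw: "z \<notin> \<real>\<^sub>\<le>\<^sub>0" "w \<notin> \<real>\<^sub>\<le>\<^sub>0" by auto
    show "\<kappa>_fun z w = G_fun z w - G_fun w z" by (rule \<kappa>_fun_def)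
    show "has_RL_derivative (\<lambda>x. G_fun x w) (1 / lam) z (rhs_G lam c G_fun z w)"
      by (rule G_fun_RL[OF zw(1)])
    show "has_RL_derivative (\<lambda>x. \<kappa>_fun x w) (1 / lam) z (rhs_\<kappa> lam c \<kappa>_fun z w)"
      by (rule \<kappa>_fun_RL[OF zw])
    show "has_caputo_derivative (\<lambda>x. G_fun x w) (1 / lam) z (rhs_G lam c G_fun z w)"
      if "1 / lam \<in> \<nat> \<or> of_int \<lceil>1 / lam\<rceil> < (2 + c) / lam"
      by (rule G_fun_caputo[OF zw(1) that])
    show "has_caputo_derivative (\<lambda>x. \<kappa>_fun x w) (1 / lam) z (rhs_\<kappa> lam c \<kappa>_fun z w)"
      if "1 / lam \<in> \<nat> \<or> of_int \<lceil>1 / lam\<rceil> < (1 + c) / lam"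
      by (rule \<kappa>_fun_caputo[OF zw that])
  qed (use cocycle_phase kernel_uniform_limit weighted_kernel_uniform_limit_neg \<kappa>_lim_limit_prekernel
      G_fun_holomorphic in blast)+
qed

end
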